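(* Let $S$ be a smooth orientable two-manifold and let $\Gamma$ be a finite simplicial graph. Then there is an injective group homomorphism $A(\Gamma)\to \mathrm{Diff}^{\infty}(S)$.
   Context: For a finite simplicial graph $\Gamma$ with vertex set $V$ and edge set $E$, the right-angled Artin group is $A(\Gamma)=\langle V\mid [v,w]=1 \text{ whenever } \{v,w\}\in E\rangle$. For an orientable smooth manifold $M$, $\mathrm{Diff}^{\infty}(M)$ denotes the group of orientation-preserving $C^{\infty}$ diffeomorphisms of $M$. Manifolds are nonempty. *)

theory Defs
  imports "HOL-Analysis.Analysis" "HOL-Algebra.Bij"
begin

section \<open>Groups given by presentations; right-angled Artin groups\<close>

text \<open>A letter \<open>(s, True)\<close> stands for the generator \<open>s\<close> and \<open>(s, False)\<close> for its formal
  inverse.\<close>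

type_synonym 's word = "('s \<times> bool) list"

abbreviation words :: "'s set \<Rightarrow> 's word set" where
  "words S \<equiv> lists (S \<times> UNIV)"

text \<open>The congruence on words over \<open>S\<close> generated by \<open>s s\<^sup>-\<^sup>1 = 1 = s\<^sup>-\<^sup>1 s\<close> for \<open>s \<in> S\<close> and
  \<open>r = 1\<close> for \<open>r \<in> R\<close>. Its classes are the elements of the quotient of the free group on \<open>S\<close> by
  the normal closure of \<open>R\<close>.\<close>

inductive word_eq :: "'s set \<Rightarrow> 's word set \<Rightarrow> 's word \<Rightarrow> 's word \<Rightarrow> bool"
  for S :: "'s set" and R :: "'s word set" where
  refl: "w \<in> words S \<Longrightarrow> word_eq S R w w"
| sym: "word_eq S R u v \<Longrightarrow> word_eq S R v u"
| trans: "word_eq S R u v \<Longrightarrow> word_eq S R v w \<Longrightarrow> word_eq S R u w"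
| cancel: "u \<in> words S \<Longrightarrow> v \<in> words S \<Longrightarrow> s \<in> S \<Longrightarrow>
    word_eq S R (u @ [(s, b), (s, \<not> b)] @ v) (u @ v)"
| relator: "u \<in> words S \<Longrightarrow> v \<in> words S \<Longrightarrow> r \<in> R \<inter> words S \<Longrightarrow>
    word_eq S R (u @ r @ v) (u @ v)"

definition presented_group :: "'s set \<Rightarrow> 's word set \<Rightarrow> 's word set monoid" where
  "presented_group S R =
     \<lparr>carrier = words S // {(u, v). word_eq S R u v},
      mult = (\<lambda>A B. {w. \<exists>u\<in>A. \<exists>v\<in>B. word_eq S R (u @ v) w}),
      one = {w. word_eq S R [] w}\<rparr>"

definition commutator_word :: "'s \<Rightarrow> 's \<Rightarrow> 's word" where
  "commutator_word v w = [(v, True), (w, True), (v, False), (w, False)]"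

definition finite_simplicial_graph :: "'v set \<Rightarrow> 'v set set \<Rightarrow> bool" where
  "finite_simplicial_graph V E \<longleftrightarrow> finite V \<and> E \<subseteq> {e. e \<subseteq> V \<and> card e = 2}"

definition raag :: "'v set \<Rightarrow> 'v set set \<Rightarrow> 'v word set monoid" where
  "raag V E = presented_group V {commutator_word v w | v w. {v, w} \<in> E}"

lemma word_eq_words: "word_eq S R u v \<Longrightarrow> u \<in> words S \<and> v \<in> words S"
  by (induction rule: word_eq.induct) auto

lemma word_eq_append_left: "word_eq S R u v \<Longrightarrow> w \<in> words S \<Longrightarrow> word_eq S R (w @ u) (w @ v)"
proof (induction rule: word_eq.induct)
  case (cancel u v s b)
  then show ?case using word_eq.cancel[of "w @ u" S v s R b] by simp
next
  case (relator u v r)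
  then show ?case using word_eq.relator[of "w @ u" S v r R] by simp
next
  case (refl u)
  then show ?case by (intro word_eq.refl) auto
next
  case sym
  then show ?case by (simp add: word_eq.sym)
next
  case trans
  then show ?case using word_eq.trans by metis
qed

lemma word_eq_append_right: "word_eq S R u v \<Longrightarrow> w \<in> words S \<Longrightarrow> word_eq S R (u @ w) (v @ w)"
proof (induction rule: word_eq.induct)
  case (cancel u v s b)
  then show ?case using word_eq.cancel[of u S "v @ w" s R b] by simp
next
  case (relator u v r)
  then show ?case using word_eq.relator[of u S "v @ w" r R] by simp
next
  case (refl u)
  then show ?case by (intro word_eq.refl) auto
next
  case sym
  then show ?case by (simp add: word_eq.sym)
next
  case trans
  then show ?case using word_eq.trans by metis
qed

lemma word_eq_append:
  "word_eq S R u u' \<Longrightarrow> word_eq S R v v' \<Longrightarrow> word_eq S R (u @ v) (u' @ v')"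
  by (meson word_eq.trans word_eq_append_left word_eq_append_right word_eq_words)

lemma presented_group_carrier:
  "carrier (presented_group S R) = (\<lambda>u. {w. word_eq S R u w}) ` words S"
  by (auto simp: presented_group_def quotient_def)

lemma presented_group_mult:
  assumes "u \<in> words S" "v \<in> words S"
  shows "{w. word_eq S R u w} \<otimes>\<^bsub>presented_group S R\<^esub> {w. word_eq S R v w}
         = {w. word_eq S R (u @ v) w}"
proof -
  have "word_eq S R u u" "word_eq S R v v"
    using assms by (auto intro: word_eq.refl)
  then have "(\<exists>u'\<in>{w. word_eq S R u w}. \<exists>v'\<in>{w. word_eq S R v w}. word_eq S R (u' @ v') w)
      \<longleftrightarrow> word_eq S R (u @ v) w" for w
    using word_eq.trans[OF word_eq_append] by auto
  then show ?thesis by (simp add: presented_group_def)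
qed

lemma word_eq_left_inverse:
  "u \<in> words S \<Longrightarrow> word_eq S R (rev (map (\<lambda>(s, b). (s, \<not> b)) u) @ u) []"
proof (induction u)
  case (Cons a u)
  obtain s b where a: "a = (s, b)" by force
  let ?i = "rev (map (\<lambda>(s, b). (s, \<not> b)) u)"
  have "?i \<in> words S" using Cons.prems by auto
  then have "word_eq S R (?i @ [(s, \<not> b), (s, \<not> \<not> b)] @ u) (?i @ u)"
    using Cons.prems a by (intro word_eq.cancel) auto
  then show ?case using Cons a by (auto intro: word_eq.trans)
qed (auto intro: word_eq.refl)

lemma group_presented_group: "group (presented_group S R)"
proof (rule groupI)
  have one: "\<one>\<^bsub>presented_group S R\<^esub> = {w. word_eq S R [] w}"
    by (simp add: presented_group_def)
  show "\<one>\<^bsub>presented_group S R\<^esub> \<in> carrier (presented_group S R)"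
    by (simp add: one presented_group_carrier)
  show "\<And>x. x \<in> carrier (presented_group S R) \<Longrightarrow>
      \<one>\<^bsub>presented_group S R\<^esub> \<otimes>\<^bsub>presented_group S R\<^esub> x = x"
    unfolding one presented_group_carrier using presented_group_mult[of "[]" S _ R] by auto
  fix x y assume "x \<in> carrier (presented_group S R)" "y \<in> carrier (presented_group S R)"
  then obtain u v where uv: "u \<in> words S" "v \<in> words S"
    "x = {w. word_eq S R u w}" "y = {w. word_eq S R v w}"
    by (auto simp: presented_group_carrier)
  then show "x \<otimes>\<^bsub>presented_group S R\<^esub> y \<in> carrier (presented_group S R)"
    by (auto simp: presented_group_mult presented_group_carrier)
  {
    fix z assume "z \<in> carrier (presented_group S R)"
    then obtain t where "t \<in> words S" "z = {w. word_eq S R t w}"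
      by (auto simp: presented_group_carrier)
    with uv show "x \<otimes>\<^bsub>presented_group S R\<^esub> y \<otimes>\<^bsub>presented_group S R\<^esub> z =
        x \<otimes>\<^bsub>presented_group S R\<^esub> (y \<otimes>\<^bsub>presented_group S R\<^esub> z)"
      using presented_group_mult[of "u @ v" S t R] presented_group_mult[of u S "v @ t" R]
      by (simp add: presented_group_mult)
  }
next
  fix x assume "x \<in> carrier (presented_group S R)"
  then obtain u where u: "u \<in> words S" "x = {w. word_eq S R u w}"
    by (auto simp: presented_group_carrier)
  let ?i = "rev (map (\<lambda>(s, b). (s, \<not> b)) u)"
  have i: "?i \<in> words S" using u by auto
  have "{w. word_eq S R (?i @ u) w} = {w. word_eq S R [] w}"
    using word_eq_left_inverse[OF u(1), of R] by (blast intro: word_eq.intros)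
  then show "\<exists>y\<in>carrier (presented_group S R).
      y \<otimes>\<^bsub>presented_group S R\<^esub> x = \<one>\<^bsub>presented_group S R\<^esub>"
    using u i presented_group_mult[OF i u(1), of R]
    by (intro bexI[of _ "{w. word_eq S R ?i w}"])
      (auto simp: presented_group_carrier, auto simp: presented_group_def)
qed


section \<open>Smooth manifolds and their diffeomorphism groups\<close>

text \<open>The following is meant for open \<open>S\<close>: a function is of class \<open>C\<^sup>k\<^sup>+\<^sup>1\<close> iff it is differentiable
  and all its directional derivatives are of class \<open>C\<^sup>k\<close>.\<close>

primrec Ck_on ::
  "nat \<Rightarrow> ('b::euclidean_space \<Rightarrow> 'c::real_normed_vector) \<Rightarrow> 'b set \<Rightarrow> bool" where
  "Ck_on 0 f S \<longleftrightarrow> continuous_on S f"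
| "Ck_on (Suc k) f S \<longleftrightarrow> (\<forall>x\<in>S. f differentiable (at x)) \<and>
     (\<forall>v. Ck_on k (\<lambda>x. frechet_derivative f (at x) v) S)"

definition Cinf_on ::
  "('b::euclidean_space \<Rightarrow> 'c::real_normed_vector) \<Rightarrow> 'b set \<Rightarrow> bool" where
  "Cinf_on f S \<longleftrightarrow> (\<forall>k. Ck_on k f S)"

text \<open>A chart is a pair \<open>(U, \<phi>)\<close>; the values of \<open>\<phi>\<close> outside \<open>U\<close> are irrelevant.\<close>

type_synonym ('a, 'n) chart = "'a set \<times> ('a \<Rightarrow> real ^ 'n)"

definition chart_on :: "'a topology \<Rightarrow> ('a, 'n::finite) chart \<Rightarrow> bool" where
  "chart_on X = (\<lambda>(U, \<phi>). openin X U \<and> open (\<phi> ` U) \<and>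
     homeomorphic_map (subtopology X U) (top_of_set (\<phi> ` U)) \<phi>)"

text \<open>The expression of a map \<open>f\<close> in charts \<open>(U, \<phi>)\<close> of the source and \<open>(V, \<psi>)\<close> of the target is
  \<open>\<psi> \<circ> f \<circ> \<phi>\<^sup>-\<^sup>1\<close>, considered on \<open>\<phi>(U \<inter> f\<^sup>-\<^sup>1(V))\<close>.\<close>

definition local_dom ::
  "('a, 'n::finite) chart \<Rightarrow> ('b, 'm::finite) chart \<Rightarrow> ('a \<Rightarrow> 'b) \<Rightarrow> (real ^ 'n) set" where
  "local_dom c d f = snd c ` {x \<in> fst c. f x \<in> fst d}"

definition local_expr ::
  "('a, 'n::finite) chart \<Rightarrow> ('b, 'm::finite) chart \<Rightarrow> ('a \<Rightarrow> 'b) \<Rightarrow> real ^ 'n \<Rightarrow> real ^ 'm" where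
  "local_expr c d f = snd d \<circ> f \<circ> inv_into (fst c) (snd c)"

definition smooth_atlas :: "'a topology \<Rightarrow> ('a, 'n::finite) chart set \<Rightarrow> bool" where
  "smooth_atlas X \<A> \<longleftrightarrow> (\<forall>c\<in>\<A>. chart_on X c) \<and> (\<Union>c\<in>\<A>. fst c) = topspace X \<and>
     (\<forall>c\<in>\<A>. \<forall>d\<in>\<A>. Cinf_on (local_expr c d id) (local_dom c d id))"

text \<open>The smooth structure is given by an atlas, which need not be maximal; the notions below
  only depend on the maximal atlas it generates. The dimension is \<open>CARD('n)\<close>.\<close>

definition smooth_manifold :: "'a topology \<Rightarrow> ('a, 'n::finite) chart set \<Rightarrow> bool" where
  "smooth_manifold X \<A> \<longleftrightarrow>
     topspace X \<noteq> {} \<and> Hausdorff_space X \<and> second_countable X \<and> smooth_atlas X \<A>"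

definition smooth_map ::
  "'a topology \<Rightarrow> ('a, 'n::finite) chart set \<Rightarrow> 'b topology \<Rightarrow> ('b, 'm::finite) chart set
     \<Rightarrow> ('a \<Rightarrow> 'b) \<Rightarrow> bool" where
  "smooth_map X \<A> Y \<B> f \<longleftrightarrow> continuous_map X Y f \<and>
     (\<forall>c\<in>\<A>. \<forall>d\<in>\<B>. Cinf_on (local_expr c d f) (local_dom c d f))"

definition preserves_orientation_in ::
  "('a, 'n::finite) chart set \<Rightarrow> ('a \<Rightarrow> 'a) \<Rightarrow> bool" where
  "preserves_orientation_in \<O> f \<longleftrightarrow> (\<forall>c\<in>\<O>. \<forall>d\<in>\<O>. \<forall>p\<in>local_dom c d f.
     det (matrix (frechet_derivative (local_expr c d f) (at p))) > 0)"

text \<open>An orientation of \<open>(X, \<A>)\<close> is given by an atlas \<open>\<O>\<close> of charts that are smoothly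
  compatible with \<open>\<A>\<close> and whose transition maps have positive Jacobian determinant.\<close>

definition orientation_of ::
  "'a topology \<Rightarrow> ('a, 'n::finite) chart set \<Rightarrow> ('a, 'n) chart set \<Rightarrow> bool" where
  "orientation_of X \<A> \<O> \<longleftrightarrow>
     smooth_atlas X \<O> \<and> smooth_atlas X (\<A> \<union> \<O>) \<and> preserves_orientation_in \<O> id"

definition orientable :: "'a topology \<Rightarrow> ('a, 'n::finite) chart set \<Rightarrow> bool" where
  "orientable X \<A> \<longleftrightarrow> (\<exists>\<O>. orientation_of X \<A> \<O>)"

text \<open>Diffeomorphisms are represented, as in \<^const>\<open>BijGroup\<close>, by functions that are
  \<^const>\<open>undefined\<close> outside the manifold.\<close>

definition Diff_group ::
  "'a topology \<Rightarrow> ('a, 'n::finite) chart set \<Rightarrow> ('a, 'n) chart set \<Rightarrow> ('a \<Rightarrow> 'a) monoid" where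
  "Diff_group X \<A> \<O> = (BijGroup (topspace X))
     \<lparr>carrier := {f \<in> Bij (topspace X). smooth_map X \<A> X \<A> f \<and>
        smooth_map X \<A> X \<A> (inv_into (topspace X) f) \<and> preserves_orientation_in \<O> f}\<rparr>"

end

theory Submission
  imports Defs
begin

text \<open>
  It is enough to let the group \<open>A(\<Gamma>)\<close> act faithfully on the complex plane by diffeomorphisms supported in
  a fixed disc (\<open>faithful_action_on_disc\<close>). Such maps can be shrunk, transplanted into a chart and extended
  by the identity (locale \<open>chart_support\<close>); they preserve the orientation because a compactly supported
  diffeomorphism of a vector space has positive Jacobian determinant (\<open>jacobian_det_pos_of_compact_support\<close>).

  Every generator acts as a product of double twists around finitely many disjoint thin annuli. The annuli form a
  tree. The root is an annulus around the unit circle; its children are small annuli centred on this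
  circle, one for each vertex of \<open>\<Gamma>\<close>, and each of them crosses the root annulus. An annulus labelled by
  the vertex \<open>b\<close> has in turn one small child for each vertex different from \<open>b\<close> and not adjacent to it,
  and so on, with as many levels as \<open>\<Gamma>\<close> has vertices. Two annuli meet only if one is the parent of the
  other. Therefore adjacent vertices act with disjoint supports and commute
  (\<open>tree_map_disjoint_supports\<close>).

  Faithfulness is a ping-pong argument with paths. A path crosses an annulus if it joins the two boundary
  circles within a half plane, and sweeps around it if its angle changes by at least \<open>3\<pi>\<close>. A non-zero
  power of the double twist turns a crossing path into a sweeping one (\<open>crosses_imp_twist_sweeps\<close>), and a
  path sweeping around an annulus contains paths crossing its children and its parent (\<open>enter_child\<close>,
  \<open>exit_child\<close>). By induction on the alphabet \<open>S\<close> one shows (\<open>moves_across\<close>): if the children of the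
  root are labelled by \<open>N\<close>, and \<open>g\<close> is a word over \<open>S\<close> that is not equal in the group to a word over \<open>S - N\<close>, then
  \<open>g\<close> maps every path sweeping around the root annulus to a path containing a crossing of it. For this
  one picks a letter \<open>b\<close> in \<open>S \<inter> N\<close> and writes
  \<open>g = g\<^sub>0 B\<^sub>1 g\<^sub>1 \<dots> B\<^sub>m g\<^sub>m\<close> with non-trivial powers \<open>B\<^sub>i\<close> of \<open>b\<close> separated by words without \<open>b\<close> that are not
  in the subgroup generated by the link of \<open>b\<close> (\<open>alternating_decomposition\<close>). The path enters the
  annulus of \<open>b\<close> where it meets the root annulus, a place at which the letters of \<open>g\<^sub>m\<close> act trivially. The
  powers of \<open>b\<close> make it sweep around this annulus, and the words between them, whose alphabet is smaller, make
  it cross the annulus again. In the end it sweeps around the annulus of \<open>b\<close> and thus crosses the root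
  annulus where \<open>g\<^sub>0\<close> acts trivially.

  When all vertices label children of the root, every non-trivial element is covered by this
  statement. It moves some point of the unit circle, for a path along the circle sweeps around the root
  annulus and contains no crossing. The induction is on the alphabet and not on the length of the
  word, so a single finite tree serves all words at once.
\<close>

section \<open>Words in a right-angled Artin group\<close>

definition exponent_sum :: "'s word \<Rightarrow> int" where
  "exponent_sum w = (\<Sum>l\<leftarrow>w. if snd l then 1 else -1)"

lemma exponent_sum_simps [simp]:
  "exponent_sum [] = 0"
  "exponent_sum (l # w) = (if snd l then 1 else -1) + exponent_sum w"
  by (auto simp: exponent_sum_def)

locale raag_words =
  fixes V :: "'v set" and E :: "'v set set"
  assumes graph: "finite_simplicial_graph V E"
begin

lemma edge_neq: "{u, v} \<in> E \<Longrightarrow> u \<noteq> v"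
  using graph unfolding finite_simplicial_graph_def by (cases "u = v") auto

abbreviation raag_eq :: "'v word \<Rightarrow> 'v word \<Rightarrow> bool" (infix "\<doteq>" 50) where
  "u \<doteq> v \<equiv> word_eq V {commutator_word v w | v w. {v, w} \<in> E} u v"

lemma edge_commutes_pos:
  assumes "u \<in> V" "v \<in> V" "{u, v} \<in> E"
  shows "[(u, True), (v, True)] \<doteq> [(v, True), (u, True)]"
proof -
  let ?R = "{commutator_word v w | v w. {v, w} \<in> E}"
  have "[] @ commutator_word u v @ [(v, True), (u, True)] \<doteq> [] @ [(v, True), (u, True)]"
    using assms by (intro word_eq.relator) (auto simp: commutator_word_def)
  moreover have "[(u, True), (v, True), (u, False)] @ [(v, False), (v, \<not> False)] @ [(u, True)]
      \<doteq> [(u, True), (v, True), (u, False)] @ [(u, True)]"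
    using assms by (intro word_eq.cancel) auto
  moreover have "[(u, True), (v, True)] @ [(u, False), (u, \<not> False)] @ [] \<doteq> [(u, True), (v, True)] @ []"
    using assms by (intro word_eq.cancel) auto
  ultimately show ?thesis
    by (simp add: commutator_word_def) (meson word_eq.sym word_eq.trans)
qed

text \<open>Multiplying a commutation relation on both sides by the inverse of one of its letters gives the
  relation for that inverse.\<close>

lemma commutes_flip:
  assumes "u \<in> V" "v \<in> V" "[(u, x), (v, y)] \<doteq> [(v, y), (u, x)]"
  shows "[(u, \<not> x), (v, y)] \<doteq> [(v, y), (u, \<not> x)]"
proof -
  have "[(u, \<not> x), (v, y)] @ [(u, x), (u, \<not> x)] @ [] \<doteq> [(u, \<not> x), (v, y)] @ []"
    using assms by (intro word_eq.cancel) auto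
  moreover have "[(u, \<not> x)] @ ([(u, x), (v, y)] @ [(u, \<not> x)]) \<doteq> [(u, \<not> x)] @ ([(v, y), (u, x)] @ [(u, \<not> x)])"
    using assms by (intro word_eq_append_left word_eq_append_right) auto
  moreover have "[] @ [(u, \<not> x), (u, \<not> \<not> x)] @ [(v, y), (u, \<not> x)] \<doteq> [] @ [(v, y), (u, \<not> x)]"
    using assms by (intro word_eq.cancel) auto
  ultimately show ?thesis
    by simp (meson word_eq.sym word_eq.trans)
qed

lemma edge_commutes:
  assumes "u \<in> V" "v \<in> V" "{u, v} \<in> E"
  shows "[(u, x), (v, y)] \<doteq> [(v, y), (u, x)]"
proof -
  have 1: "[(u, x), (v, True)] \<doteq> [(v, True), (u, x)]"
    using edge_commutes_pos[OF assms] commutes_flip[OF assms(1,2), of True True]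
    by (cases x) auto
  then have "[(v, True), (u, x)] \<doteq> [(u, x), (v, True)]"
    by (rule word_eq.sym)
  then have "[(v, y), (u, x)] \<doteq> [(u, x), (v, y)]"
    using commutes_flip[OF assms(2,1), of True x] by (cases y) auto
  then show ?thesis by (rule word_eq.sym)
qed

lemma letter_commutes_link_word:
  assumes "b \<in> V" "w \<in> words {u \<in> V. {u, b} \<in> E}"
  shows "(b, x) # w \<doteq> w @ [(b, x)]"
  using assms(2)
proof (induction w)
  case Nil
  then show ?case using assms by (auto intro: word_eq.refl)
next
  case (Cons l w)
  obtain u y where l: "l = (u, y)" by force
  have u: "u \<in> V" "{b, u} \<in> E" and w: "w \<in> words V" "w \<in> words {u \<in> V. {u, b} \<in> E}"
    using Cons l by (auto simp: insert_commute)
  have "[(b, x), l] @ w \<doteq> [l, (b, x)] @ w"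
    unfolding l using edge_commutes assms u w by (intro word_eq_append_right) auto
  moreover have "[l] @ ((b, x) # w) \<doteq> [l] @ (w @ [(b, x)])"
    using Cons.IH w u l by (intro word_eq_append_left) auto
  ultimately show ?case by simp (meson word_eq.trans)
qed

lemma one_letter_word_normal_form:
  assumes "b \<in> V" "B \<in> words {b}"
  shows "B \<doteq> replicate (nat \<bar>exponent_sum B\<bar>) (b, exponent_sum B > 0)"
  using assms(2)
proof (induction B)
  case Nil
  then show ?case by (auto intro: word_eq.refl)
next
  case (Cons l B)
  obtain s where l: "l = (b, s)" and B: "B \<in> words {b}" using Cons by auto
  define k where "k = exponent_sum B"
  let ?p = "\<lambda>k::int. replicate (nat \<bar>k\<bar>) (b, k > 0)"
  let ?k' = "(if s then 1 else -1) + k"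
  have pw: "?p j \<in> words V" for j using assms by auto
  have 1: "[l] @ B \<doteq> [l] @ ?p k"
    using Cons.IH assms l unfolding k_def by (intro word_eq_append_left) auto
  have 2: "[l] @ ?p k \<doteq> ?p ?k'"
  proof (cases "k = 0 \<or> (k > 0 \<longleftrightarrow> s)")
    case True
    have n: "nat \<bar>?k'\<bar> = Suc (nat \<bar>k\<bar>)" using True by (auto split: if_splits)
    have p: "(?k' > 0) = s" using True by auto
    have "replicate (nat \<bar>k\<bar>) (b, k > 0) = replicate (nat \<bar>k\<bar>) (b, s)"
      using True by (cases "k = 0") auto
    then have eq: "[l] @ ?p k = ?p ?k'"
      unfolding n l p by simp
    show ?thesis unfolding eq using pw by (rule word_eq.refl)
  next
    case False
    then have n: "nat \<bar>k\<bar> = Suc (nat \<bar>?k'\<bar>)" and s: "(k > 0) = (\<not> s)" by (auto split: if_splits)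
    have s': "?k' = 0 \<or> (?k' > 0) = (\<not> s)" using False by auto
    have "[] @ [(b, s), (b, \<not> s)] @ ?p ?k' \<doteq> [] @ ?p ?k'"
      using assms pw by (intro word_eq.cancel) auto
    moreover have "[l] @ ?p k = [] @ [(b, s), (b, \<not> s)] @ ?p ?k'"
      unfolding n l s using s' by auto
    ultimately show ?thesis by simp
  qed
  show ?case using word_eq.trans[OF 1 2] l k_def by simp
qed

lemma one_letter_word_trivial:
  assumes "b \<in> V" "B \<in> words {b}" "exponent_sum B = 0"
  shows "B \<doteq> []"
  using one_letter_word_normal_form[OF assms(1,2)] assms(3) by simp

text \<open>Products \<open>B\<^sub>1 g\<^sub>1 B\<^sub>2 g\<^sub>2 \<dots> B\<^sub>m g\<^sub>m\<close> with \<open>m \<ge> 1\<close>, where the blocks \<open>B\<^sub>i\<close> are non-trivial powers of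
  the letter \<open>b\<close>, the \<open>g\<^sub>i\<close> avoid \<open>b\<close>, and no two consecutive blocks can be merged, because the word
  between them does not lie in the subgroup generated by the link of \<open>b\<close>. The last factor \<open>g\<^sub>m\<close> is
  arbitrary.\<close>

inductive alternating :: "'v set \<Rightarrow> 'v \<Rightarrow> 'v word \<Rightarrow> bool" for S b where
  single: "B \<in> words {b} \<Longrightarrow> exponent_sum B \<noteq> 0 \<Longrightarrow> g \<in> words (S - {b}) \<Longrightarrow>
    alternating S b (B @ g)"
| step: "B \<in> words {b} \<Longrightarrow> exponent_sum B \<noteq> 0 \<Longrightarrow> g \<in> words (S - {b}) \<Longrightarrow>
    \<not> (\<exists>g'\<in>words {u \<in> S. {u, b} \<in> E}. g \<doteq> g') \<Longrightarrow> alternating S b h \<Longrightarrow>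
    alternating S b (B @ g @ h)"

lemma alternating_words: "alternating S b h \<Longrightarrow> b \<in> S \<Longrightarrow> h \<in> words S"
proof (induction rule: alternating.induct)
  case (single B g)
  have "words {b} \<subseteq> words S" "words (S - {b}) \<subseteq> words S"
    using single by (auto intro!: lists_mono)
  then show ?case using single by auto
next
  case (step B g h)
  have "words {b} \<subseteq> words S" "words (S - {b}) \<subseteq> words S"
    using step by (auto intro!: lists_mono)
  then show ?case using step by auto
qed

text \<open>A letter \<open>b\<close> in front of an alternating product joins its first block. If this makes the block
  trivial, the block disappears and the product may begin with letters other than \<open>b\<close> or lose
  its last block.\<close>

lemma alternating_Cons:
  assumes "alternating S b h" "S \<subseteq> V" "b \<in> S"
  shows "alternating S b ((b, x) # h) \<or> (\<exists>g\<in>words (S - {b}). (b, x) # h \<doteq> g) \<or>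
    (\<exists>g\<in>words (S - {b}). \<exists>h'. alternating S b h' \<and> (b, x) # h \<doteq> g @ h')"
  using assms(1)
proof cases
  case (single B g)
  let ?B = "(b, x) # B"
  have B: "?B \<in> words {b}" using single by auto
  show ?thesis
  proof (cases "exponent_sum ?B = 0")
    case False
    then have "alternating S b (?B @ g)"
      using single B by (intro alternating.single)
    then show ?thesis using single by simp
  next
    case True
    have "words (S - {b}) \<subseteq> words V" using assms by (intro lists_mono) auto
    then have "?B @ g \<doteq> [] @ g"
      using True B assms single by (intro word_eq_append_right one_letter_word_trivial[of b]) auto
    then show ?thesis using single by auto
  qed
next
  case (step B g h')
  let ?B = "(b, x) # B"
  have B: "?B \<in> words {b}" using step by auto
  show ?thesis
  proof (cases "exponent_sum ?B = 0")
    case False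
    then have "alternating S b (?B @ g @ h')"
      using step B by (intro alternating.step)
    then show ?thesis using step by simp
  next
    case True
    have "words (S - {b}) \<subseteq> words V" "words S \<subseteq> words V" using assms by (auto intro!: lists_mono)
    then have "?B @ (g @ h') \<doteq> [] @ (g @ h')"
      using True B assms step alternating_words[of S b h']
      by (intro word_eq_append_right one_letter_word_trivial[of b]) auto
    then show ?thesis using step by auto
  qed
qed

text \<open>The word is built up from its last letter. When a letter \<open>b\<close> is put in front of \<open>g h\<close> with \<open>h\<close>
  alternating, it opens a new block unless \<open>g\<close> is equal to a word in the link of \<open>b\<close>; in that case
  it slides past \<open>g\<close> and is absorbed by the first block of \<open>h\<close>.\<close>

lemma alternating_decomposition:
  assumes "w \<in> words S" "S \<subseteq> V" "b \<in> S"
  shows "(\<exists>g\<in>words (S - {b}). w \<doteq> g) \<or>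
    (\<exists>g\<in>words (S - {b}). \<exists>h. alternating S b h \<and> w \<doteq> g @ h)"
  using assms(1)
proof (induction w)
  case Nil
  then show ?case by (auto intro!: bexI[of _ "[]"] word_eq.refl)
next
  case (Cons l w)
  obtain v x where l: "l = (v, x)" by force
  have v: "v \<in> S" and w: "w \<in> words S" using Cons l by auto
  have sub: "words (S - {b}) \<subseteq> words V" "words S \<subseteq> words V" "words {u \<in> S. {u, b} \<in> E} \<subseteq> words V"
    "words {u \<in> S. {u, b} \<in> E} \<subseteq> words {u \<in> V. {u, b} \<in> E}"
    using assms by (auto intro!: lists_mono)
  have lV: "[l] \<in> words V" using l v assms by auto
  consider g where "g \<in> words (S - {b})" "w \<doteq> g" |
    g h where "g \<in> words (S - {b})" "alternating S b h" "w \<doteq> g @ h"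
    using Cons.IH by blast
  then show ?case
  proof cases
    case (1 g)
    have e: "l # w \<doteq> l # g" using word_eq_append_left[OF 1(2) lV] by simp
    show ?thesis
    proof (cases "v = b")
      case False
      then have "l # g \<in> words (S - {b})" using 1 l v by auto
      then show ?thesis using e by blast
    next
      case True
      have "alternating S b ([l] @ g)"
        using True 1 l by (intro alternating.single) auto
      then show ?thesis using e by (intro disjI2 bexI[of _ "[]"] exI[of _ "[l] @ g"]) auto
    qed
  next
    case (2 g h)
    have e: "l # w \<doteq> l # g @ h" using word_eq_append_left[OF 2(3) lV] by simp
    have hV: "h \<in> words V" using alternating_words[OF 2(2)] assms sub by auto
    show ?thesis
    proof (cases "v = b")
      case False
      then have "l # g \<in> words (S - {b})" using 2 l v by auto
      then show ?thesis using e 2 by (intro disjI2 bexI[of _ "l # g"]) auto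
    next
      case True
      show ?thesis
      proof (cases "\<exists>g'\<in>words {u \<in> S. {u, b} \<in> E}. g \<doteq> g'")
        case False
        have "alternating S b ([l] @ g @ h)"
          using True 2 l False by (intro alternating.step) auto
        then show ?thesis using e by (intro disjI2 bexI[of _ "[]"] exI[of _ "[l] @ g @ h"]) auto
      next
        case t: True
        then obtain g' where g': "g' \<in> words {u \<in> S. {u, b} \<in> E}" "g \<doteq> g'" by blast
        have "[l] @ (g @ h) \<doteq> [l] @ (g' @ h)"
          using g' hV lV by (intro word_eq_append_left word_eq_append_right)
        moreover have "l # g' \<doteq> g' @ [l]"
          unfolding l True
          by (rule letter_commutes_link_word) (use g'(1) sub(4) assms in blast)+
        then have "(l # g') @ h \<doteq> (g' @ [l]) @ h"
          using hV by (intro word_eq_append_right)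
        ultimately have e2: "l # w \<doteq> g' @ (l # h)"
          using e by simp (meson word_eq.trans)
        show ?thesis
        proof -
          have "(u, y) \<in> set g' \<Longrightarrow> u \<noteq> b" for u y
            using g'(1) edge_neq by auto
          then have g'b: "g' \<in> words (S - {b})" using g'(1) by auto
          have g'V: "g' \<in> words V" using g' sub by auto
          have "alternating S b (l # h) \<or> (\<exists>a\<in>words (S - {b}). l # h \<doteq> a) \<or>
            (\<exists>a\<in>words (S - {b}). \<exists>h'. alternating S b h' \<and> l # h \<doteq> a @ h')"
            using alternating_Cons[OF 2(2) assms(2,3), of x] l True by auto
          then consider "alternating S b (l # h)" |
            a where "a \<in> words (S - {b})" "l # h \<doteq> a" |
            a h' where "a \<in> words (S - {b})" "alternating S b h'" "l # h \<doteq> a @ h'" by blast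
          then show ?thesis
          proof cases
            case 1
            then show ?thesis using e2 g'b by blast
          next
            case (2 a)
            then have "l # w \<doteq> g' @ a"
              using e2 word_eq_append_left[OF 2(2) g'V] by (meson word_eq.trans)
            then show ?thesis using g'b 2 by (intro disjI1 bexI[of _ "g' @ a"]) auto
          next
            case (3 a h')
            then have "l # w \<doteq> (g' @ a) @ h'"
              using e2 word_eq_append_left[OF 3(3) g'V] by simp (meson word_eq.trans)
            then show ?thesis using g'b 3 by (intro disjI2 bexI[of _ "g' @ a"]) auto
          qed
        qed
      qed
    qed
  qed
qed

end

section \<open>Calculus of smooth maps\<close>

lemma frechet_derivative_cong_open:
  assumes "open S" "x \<in> S" "\<And>y. y \<in> S \<Longrightarrow> f y = g y"
  shows "frechet_derivative f (at x) = frechet_derivative g (at x)"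
proof -
  have "(f has_derivative D) (at x) = (g has_derivative D) (at x)" for D
    using assms has_derivative_transform_within_open[of f D x UNIV S g]
      has_derivative_transform_within_open[of g D x UNIV S f] by auto
  then show ?thesis unfolding frechet_derivative_def by simp
qed

lemma differentiable_cong_open:
  assumes "open S" "x \<in> S" "\<And>y. y \<in> S \<Longrightarrow> f y = g y" "f differentiable (at x)"
  shows "g differentiable (at x)"
  using assms has_derivative_transform_within_open[of f _ x UNIV S g]
  unfolding differentiable_def by auto

lemma Ck_on_cong_imp:
  assumes "open S" "\<And>y. y \<in> S \<Longrightarrow> f y = g y" "Ck_on k f S"
  shows "Ck_on k g S"
  using assms(2,3)
proof (induction k arbitrary: f g)
  case 0
  then show ?case by (simp cong: continuous_on_cong)
next
  case (Suc k)
  have "frechet_derivative f (at x) = frechet_derivative g (at x)" if "x \<in> S" for x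
    using frechet_derivative_cong_open[OF assms(1) that] Suc.prems by auto
  then have "Ck_on k (\<lambda>x. frechet_derivative g (at x) v) S" for v
    using Suc.IH[of "\<lambda>x. frechet_derivative f (at x) v" "\<lambda>x. frechet_derivative g (at x) v"] Suc.prems
    by auto
  then show ?case
    using Suc.prems differentiable_cong_open[OF assms(1), of _ f g] by auto
qed

lemma Ck_on_subset: "Ck_on k f S \<Longrightarrow> T \<subseteq> S \<Longrightarrow> Ck_on k f T"
  by (induction k arbitrary: f) (auto intro: continuous_on_subset)

lemma Ck_on_local:
  assumes "\<And>x. x \<in> S \<Longrightarrow> \<exists>U. open U \<and> x \<in> U \<and> Ck_on k f U"
  shows "Ck_on k f S"
  using assms
proof (induction k arbitrary: f)
  case 0
  show ?case
    unfolding Ck_on.simps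
  proof (rule continuous_at_imp_continuous_on, safe)
    fix x assume "x \<in> S"
    then obtain U where "open U" "x \<in> U" "continuous_on U f" using 0[of x] by auto
    then show "isCont f x" by (simp add: continuous_on_eq_continuous_at)
  qed
next
  case (Suc k)
  show ?case
    unfolding Ck_on.simps
  proof (intro conjI ballI allI)
    fix x assume "x \<in> S"
    then show "f differentiable (at x)" using Suc.prems[of x] by auto
  next
    fix v
    show "Ck_on k (\<lambda>x. frechet_derivative f (at x) v) S"
      by (rule Suc.IH) (use Suc.prems in \<open>force\<close>)
  qed
qed

lemma Ck_on_SucD: "Ck_on (Suc k) f S \<Longrightarrow> Ck_on k f S"
proof (induction k arbitrary: f)
  case 0
  then show ?case
    by (auto intro!: continuous_at_imp_continuous_on differentiable_imp_continuous_within)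
next
  case (Suc k)
  then have "\<forall>x\<in>S. f differentiable (at x)" "\<And>v. Ck_on (Suc k) (\<lambda>x. frechet_derivative f (at x) v) S"
    using Ck_on.simps(2) by blast+
  then show ?case using Suc.IH by auto
qed

lemma Ck_on_const: "Ck_on k (\<lambda>x. c) S"
  by (induction k arbitrary: c) (auto intro: continuous_intros)

text \<open>This form avoids \<^const>\<open>frechet_derivative\<close>: any formula for the derivative will do.\<close>

lemma Ck_on_SucI:
  assumes "open S" "\<And>x. x \<in> S \<Longrightarrow> (f has_derivative D x) (at x)"
    "\<And>v. Ck_on k (\<lambda>x. D x v) S"
  shows "Ck_on (Suc k) f S"
proof -
  have "D x = frechet_derivative f (at x)" if "x \<in> S" for x
    using frechet_derivative_at[OF assms(2)[OF that]] .
  then have "Ck_on k (\<lambda>x. frechet_derivative f (at x) v) S" for v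
    using Ck_on_cong_imp[OF assms(1) _ assms(3), of v "\<lambda>x. frechet_derivative f (at x) v"] by simp
  then show ?thesis using assms(2) by (auto simp: differentiable_def)
qed

lemma Ck_on_SucD_has_derivative:
  assumes "Ck_on (Suc k) f S" "x \<in> S"
  shows "(f has_derivative frechet_derivative f (at x)) (at x)"
  using assms by (simp add: frechet_derivative_works)

lemma Ck_on_bounded_linear:
  assumes "bounded_linear L" "open S" "Ck_on k f S"
  shows "Ck_on k (\<lambda>x. L (f x)) S"
  using assms(3)
proof (induction k arbitrary: f)
  case 0
  then show ?case using bounded_linear.continuous_on[OF assms(1)] by auto
next
  case (Suc k)
  show ?case
  proof (rule Ck_on_SucI[OF assms(2), where D = "\<lambda>x v. L (frechet_derivative f (at x) v)"])
    fix x assume "x \<in> S"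
    then show "((\<lambda>x. L (f x)) has_derivative (\<lambda>v. L (frechet_derivative f (at x) v))) (at x)"
      using Ck_on_SucD_has_derivative[OF Suc.prems] bounded_linear.has_derivative[OF assms(1)] by blast
  next
    fix v show "Ck_on k (\<lambda>x. L (frechet_derivative f (at x) v)) S"
      using Suc by auto
  qed
qed

lemma Ck_on_add:
  assumes "open S" "Ck_on k f S" "Ck_on k g S"
  shows "Ck_on k (\<lambda>x. f x + g x) S"
  using assms(2,3)
proof (induction k arbitrary: f g)
  case 0
  then show ?case by (auto intro: continuous_intros)
next
  case (Suc k)
  show ?case
  proof (rule Ck_on_SucI[OF assms(1),
        where D = "\<lambda>x v. frechet_derivative f (at x) v + frechet_derivative g (at x) v"])
    fix x assume "x \<in> S"
    then show "((\<lambda>x. f x + g x) has_derivative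
        (\<lambda>v. frechet_derivative f (at x) v + frechet_derivative g (at x) v)) (at x)"
      by (intro has_derivative_add Ck_on_SucD_has_derivative[OF Suc.prems(1)]
          Ck_on_SucD_has_derivative[OF Suc.prems(2)])
  next
    fix v
    show "Ck_on k (\<lambda>x. frechet_derivative f (at x) v + frechet_derivative g (at x) v) S"
      using Suc by auto
  qed
qed

lemma Ck_on_sum:
  assumes "open S" "\<And>i. i \<in> I \<Longrightarrow> Ck_on k (f i) S"
  shows "Ck_on k (\<lambda>x. \<Sum>i\<in>I. f i x) S"
  using assms(2)
  by (induction I rule: infinite_finite_induct) (auto intro: Ck_on_const Ck_on_add[OF assms(1)])

lemma Ck_on_bilinear:
  assumes "bounded_bilinear P" "open S" "Ck_on k f S" "Ck_on k g S"
  shows "Ck_on k (\<lambda>x. P (f x) (g x)) S"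
  using assms(3,4)
proof (induction k arbitrary: f g)
  case 0
  then show ?case using bounded_bilinear.continuous_on[OF assms(1)] by auto
next
  case (Suc k)
  show ?case
  proof (rule Ck_on_SucI[OF assms(2),
        where D = "\<lambda>x v. P (f x) (frechet_derivative g (at x) v) + P (frechet_derivative f (at x) v) (g x)"])
    fix x assume "x \<in> S"
    then show "((\<lambda>x. P (f x) (g x)) has_derivative (\<lambda>v. P (f x) (frechet_derivative g (at x) v) +
        P (frechet_derivative f (at x) v) (g x))) (at x)"
      by (intro bounded_bilinear.FDERIV[OF assms(1)] Ck_on_SucD_has_derivative[OF Suc.prems(1)]
          Ck_on_SucD_has_derivative[OF Suc.prems(2)])
  next
    fix v
    have "Ck_on k f S" "Ck_on k g S" using Suc.prems Ck_on_SucD by auto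
    then show "Ck_on k (\<lambda>x. P (f x) (frechet_derivative g (at x) v) +
        P (frechet_derivative f (at x) v) (g x)) S"
      using Suc by (intro Ck_on_add[OF assms(2)]) auto
  qed
qed

text \<open>Smoothness speaks of directional derivatives in fixed directions, but the chain rule
  differentiates \<open>g\<close> in the direction \<open>f' v\<close>, which varies with the point. Expanding this direction
  in a basis turns the derivative into a sum of products of maps covered by the induction
  hypothesis.\<close>

lemma Ck_on_compose:
  fixes f :: "'a::euclidean_space \<Rightarrow> 'b::euclidean_space" and g :: "'b \<Rightarrow> 'c::real_normed_vector"
  assumes "open S" "open T" "f ` S \<subseteq> T" "Ck_on k f S" "Ck_on k g T"
  shows "Ck_on k (\<lambda>x. g (f x)) S"
  using assms(4,5)
proof (induction k arbitrary: g)
  case 0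
  then show ?case using assms(3) by (auto intro: continuous_on_compose2)
next
  case (Suc k)
  let ?D = "\<lambda>x v. \<Sum>i\<in>Basis. (frechet_derivative f (at x) v \<bullet> i) *\<^sub>R frechet_derivative g (at (f x)) i"
  show ?case
  proof (rule Ck_on_SucI[OF assms(1), where D = ?D])
    fix x assume x: "x \<in> S"
    have df: "(f has_derivative frechet_derivative f (at x)) (at x)"
      using Ck_on_SucD_has_derivative[OF Suc.prems(1) x] .
    have dg: "(g has_derivative frechet_derivative g (at (f x))) (at (f x))"
      using Ck_on_SucD_has_derivative[OF Suc.prems(2)] x assms(3) by blast
    interpret L: linear "frechet_derivative g (at (f x))"
      using dg has_derivative_linear by blast
    have "?D x v = frechet_derivative g (at (f x)) (frechet_derivative f (at x) v)" for v
    proof -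
      have "frechet_derivative g (at (f x)) (\<Sum>i\<in>Basis. (frechet_derivative f (at x) v \<bullet> i) *\<^sub>R i) = ?D x v"
        by (simp add: L.sum L.scale)
      then show ?thesis by (simp add: euclidean_representation)
    qed
    then show "((\<lambda>x. g (f x)) has_derivative ?D x) (at x)"
      using diff_chain_at[OF df dg] by (simp add: o_def fun_eq_iff)
  next
    fix v
    show "Ck_on k (\<lambda>x. ?D x v) S"
    proof (intro Ck_on_sum[OF assms(1)] Ck_on_bilinear[OF bounded_bilinear_scaleR assms(1)])
      fix i :: 'b
      show "Ck_on k (\<lambda>x. frechet_derivative f (at x) v \<bullet> i) S"
        using Suc.prems by (intro Ck_on_bounded_linear[OF bounded_linear_inner_left assms(1)]) auto
      show "Ck_on k (\<lambda>x. frechet_derivative g (at (f x)) i) S"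
        using Suc.prems Ck_on_SucD by (intro Suc.IH) auto
    qed
  qed
qed

lemma Ck_on_linear: 
  assumes "bounded_linear L" "open S" shows "Ck_on k L S"
proof (cases k)
  case 0
  then show ?thesis using assms linear_continuous_on by auto
next
  case (Suc j)
  show ?thesis unfolding Suc
    by (rule Ck_on_SucI[OF assms(2), where D = "\<lambda>x. L"])
      (auto intro: bounded_linear_imp_has_derivative assms Ck_on_const)
qed

subsection \<open>Smooth functions\<close>

lemma Cinf_on_cong_imp: "open S \<Longrightarrow> (\<And>y. y \<in> S \<Longrightarrow> f y = g y) \<Longrightarrow> Cinf_on f S \<Longrightarrow> Cinf_on g S"
  unfolding Cinf_on_def using Ck_on_cong_imp by blast

lemma Cinf_on_subset: "Cinf_on f S \<Longrightarrow> T \<subseteq> S \<Longrightarrow> Cinf_on f T"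
  unfolding Cinf_on_def using Ck_on_subset by blast

lemma Cinf_on_local:
  "(\<And>x. x \<in> S \<Longrightarrow> \<exists>U. open U \<and> x \<in> U \<and> Cinf_on f U) \<Longrightarrow> Cinf_on f S"
  unfolding Cinf_on_def by (meson Ck_on_local)

lemma Cinf_on_const: "Cinf_on (\<lambda>x. c) S"
  unfolding Cinf_on_def by (simp add: Ck_on_const)

lemma Cinf_on_linear: "bounded_linear L \<Longrightarrow> open S \<Longrightarrow> Cinf_on L S"
  unfolding Cinf_on_def by (simp add: Ck_on_linear)

lemma Cinf_on_add: "open S \<Longrightarrow> Cinf_on f S \<Longrightarrow> Cinf_on g S \<Longrightarrow> Cinf_on (\<lambda>x. f x + g x) S"
  unfolding Cinf_on_def by (simp add: Ck_on_add)

lemma Cinf_on_bilinear: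
  "bounded_bilinear P \<Longrightarrow> open S \<Longrightarrow> Cinf_on f S \<Longrightarrow> Cinf_on g S \<Longrightarrow> Cinf_on (\<lambda>x. P (f x) (g x)) S"
  unfolding Cinf_on_def by (simp add: Ck_on_bilinear)

lemma Cinf_on_compose:
  fixes f :: "'a::euclidean_space \<Rightarrow> 'b::euclidean_space" and g :: "'b \<Rightarrow> 'c::real_normed_vector"
  shows "open S \<Longrightarrow> open T \<Longrightarrow> f ` S \<subseteq> T \<Longrightarrow> Cinf_on f S \<Longrightarrow> Cinf_on g T \<Longrightarrow> Cinf_on (\<lambda>x. g (f x)) S"
  unfolding Cinf_on_def using Ck_on_compose[of S T f _ g] by blast

lemma Cinf_on_imp_continuous_on: "Cinf_on f S \<Longrightarrow> continuous_on S f"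
  unfolding Cinf_on_def using Ck_on.simps(1) by blast

lemma Cinf_on_has_derivative:
  "Cinf_on f S \<Longrightarrow> x \<in> S \<Longrightarrow> (f has_derivative frechet_derivative f (at x)) (at x)"
  unfolding Cinf_on_def using Ck_on_SucD_has_derivative by blast

lemma Cinf_on_frechet_derivative:
  "Cinf_on f S \<Longrightarrow> Cinf_on (\<lambda>x. frechet_derivative f (at x) v) S"
  unfolding Cinf_on_def using Ck_on.simps(2) by blast

section \<open>A smooth step function\<close>

text \<open>The functions \<open>x\<^sup>-\<^sup>n e\<^sup>-\<^sup>1\<^sup>/\<^sup>x\<close>, extended by zero, are considered together because the
  derivative of each is a combination of two others; one induction then shows that they are all
  smooth, including at the origin.\<close>

definition flat_exp :: "nat \<Rightarrow> real \<Rightarrow> real" where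
  "flat_exp n x = (if x > 0 then (1 / x) ^ n * exp (- (1 / x)) else 0)"

lemma flat_exp_tendsto_0: "(flat_exp n \<longlongrightarrow> 0) (at 0)"
proof (rule filterlim_split_at)
  show "(flat_exp n \<longlongrightarrow> 0) (at_left 0)"
    by (rule tendsto_eventually) (auto simp: flat_exp_def eventually_at_filter)
  have "(((\<lambda>y. y ^ n / exp y) \<circ> inverse) \<longlongrightarrow> (0::real)) (at_right 0)"
    unfolding o_def
    by (rule filterlim_compose[OF tendsto_power_div_exp_0 filterlim_inverse_at_top_right])
  moreover have "eventually (\<lambda>x. ((\<lambda>y. y ^ n / exp y) \<circ> inverse) x = flat_exp n x) (at_right 0)"
    by (auto simp: flat_exp_def eventually_at_filter exp_minus field_simps)
  ultimately show "(flat_exp n \<longlongrightarrow> 0) (at_right 0)"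
    using tendsto_cong by fast
qed

lemma flat_exp_has_derivative:
  "(flat_exp n has_real_derivative flat_exp (n + 2) x - n * flat_exp (n + 1) x) (at x)"
proof -
  consider "x > 0" | "x < 0" | "x = 0" by linarith
  then show ?thesis
  proof cases
    case 1
    have "((\<lambda>x. (1 / x) ^ n * exp (- (1 / x))) has_real_derivative
        (n * (1 / x) ^ (n - 1) * (- (1 / x * (1 / x)))) * exp (- (1 / x)) +
        (exp (- (1 / x)) * (1 / x * (1 / x))) * (1 / x) ^ n) (at x)"
      using 1 by (auto intro!: derivative_eq_intros)
    moreover have "(n * (1 / x) ^ (n - 1) * (- (1 / x * (1 / x)))) * exp (- (1 / x)) +
        (exp (- (1 / x)) * (1 / x * (1 / x))) * (1 / x) ^ n = flat_exp (n + 2) x - n * flat_exp (n + 1) x"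
      using 1 by (cases n) (simp_all add: flat_exp_def algebra_simps add_divide_distrib)
    ultimately have "((\<lambda>x. (1 / x) ^ n * exp (- (1 / x))) has_real_derivative
        flat_exp (n + 2) x - n * flat_exp (n + 1) x) (at x)" by simp
    then show ?thesis
      by (rule has_field_derivative_transform_within_open[of _ _ _ "{0<..}"])
        (use 1 in \<open>auto simp: flat_exp_def\<close>)
  next
    case 2
    have "((\<lambda>x. 0) has_real_derivative flat_exp (n + 2) x - n * flat_exp (n + 1) x) (at x)"
      using 2 by (simp add: flat_exp_def)
    then show ?thesis
      by (rule has_field_derivative_transform_within_open[of _ _ _ "{..<0}"])
        (use 2 in \<open>auto simp: flat_exp_def\<close>)
  next
    case 3
    have "(\<lambda>y. (flat_exp n y - flat_exp n 0) / (y - 0)) = flat_exp (n + 1)"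
      by (auto simp: flat_exp_def field_simps)
    then show ?thesis
      using flat_exp_tendsto_0[of "n + 1"] 3 by (simp add: has_field_derivative_iff flat_exp_def)
  qed
qed

lemma Ck_on_flat_exp: "Ck_on k (flat_exp n) UNIV"
proof (induction k arbitrary: n)
  case 0
  show ?case
    by (auto intro!: continuous_at_imp_continuous_on DERIV_isCont flat_exp_has_derivative)
next
  case (Suc k)
  show ?case
  proof (rule Ck_on_SucI[OF open_UNIV])
    show "(flat_exp n has_derivative (*) (flat_exp (n + 2) x + (- real n) * flat_exp (n + 1) x)) (at x)" for x
      using flat_exp_has_derivative[of n x] by (simp add: has_field_derivative_def)
    show "Ck_on k (\<lambda>x. (flat_exp (n + 2) x + (- real n) * flat_exp (n + 1) x) * v) UNIV" for v
      by (intro Ck_on_bounded_linear[OF bounded_linear_mult_left] Ck_on_add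
          Ck_on_bounded_linear[OF bounded_linear_mult_right] Suc) auto
  qed
qed

lemma Ck_on_inverse: "Ck_on k (inverse :: real \<Rightarrow> real) {0<..}"
proof (induction k)
  case 0
  show ?case by (auto intro!: continuous_intros)
next
  case (Suc k)
  show ?case
  proof (rule Ck_on_SucI[OF open_greaterThan])
    show "(inverse has_derivative (\<lambda>v. - (inverse x * v * inverse x))) (at x)" if "x \<in> {0<..}" for x :: real
      using that by (auto intro!: derivative_eq_intros)
    have "Ck_on k (\<lambda>x::real. - v * (inverse x * inverse x)) {0<..}" for v
      by (intro Ck_on_bounded_linear[OF bounded_linear_mult_right]
          Ck_on_bilinear[OF bounded_bilinear_mult] Suc open_greaterThan)
    then show "Ck_on k (\<lambda>x::real. - (inverse x * v * inverse x)) {0<..}" for v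
      by (simp add: mult_ac)
  qed
qed

definition smooth_step :: "real \<Rightarrow> real" where
  "smooth_step x = flat_exp 0 x * inverse (flat_exp 0 x + flat_exp 0 (1 - x))"

lemma smooth_step_0: "x \<le> 0 \<Longrightarrow> smooth_step x = 0"
  by (simp add: smooth_step_def flat_exp_def)

lemma smooth_step_1: "x \<ge> 1 \<Longrightarrow> smooth_step x = 1"
  by (simp add: smooth_step_def flat_exp_def)

lemma Cinf_on_affine:
  fixes a :: "'a::euclidean_space" and L :: "'a \<Rightarrow> 'a"
  assumes "bounded_linear L"
  shows "Cinf_on (\<lambda>x. a + L x) UNIV"
  by (intro Cinf_on_add Cinf_on_const Cinf_on_linear assms open_UNIV)

lemma Cinf_on_smooth_step: "Cinf_on smooth_step UNIV"
proof -
  have f: "Cinf_on (flat_exp 0) UNIV"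
    by (simp add: Cinf_on_def Ck_on_flat_exp)
  have "Cinf_on (\<lambda>x. 1 + (- 1) * x :: real) UNIV"
    by (rule Cinf_on_affine[OF bounded_linear_mult_right])
  then have "Cinf_on (\<lambda>x. flat_exp 0 (1 + (- 1) * x)) UNIV"
    by (rule Cinf_on_compose[OF open_UNIV open_UNIV subset_UNIV _ f])
  then have s: "Cinf_on (\<lambda>x. flat_exp 0 x + flat_exp 0 (1 - x)) UNIV"
    using Cinf_on_add[OF open_UNIV f] by auto
  have "flat_exp 0 x + flat_exp 0 (1 - x) > 0" for x
    by (cases "x > 0"; cases "1 - x > 0") (auto simp: flat_exp_def add_pos_pos)
  then have "Cinf_on (\<lambda>x. inverse (flat_exp 0 x + flat_exp 0 (1 - x))) UNIV"
    by (intro Cinf_on_compose[OF open_UNIV open_greaterThan _ s])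
      (auto simp: Cinf_on_def Ck_on_inverse)
  then have "Cinf_on (\<lambda>x. flat_exp 0 x * inverse (flat_exp 0 x + flat_exp 0 (1 - x))) UNIV"
    by (rule Cinf_on_bilinear[OF bounded_bilinear_mult open_UNIV f])
  then show ?thesis unfolding smooth_step_def[abs_def] .
qed

lemma Ck_on_cis: "Ck_on k (\<lambda>t. c * cis t) UNIV"
proof (induction k arbitrary: c)
  case 0
  show ?case by (auto intro!: continuous_intros)
next
  case (Suc k)
  show ?case
  proof (rule Ck_on_SucI[OF open_UNIV])
    show "((\<lambda>t. c * cis t) has_derivative (\<lambda>v. v *\<^sub>R (c * \<i> * cis t))) (at t)" for t
      by (auto intro!: derivative_eq_intros ext simp: scaleR_conv_of_real algebra_simps)
    show "Ck_on k (\<lambda>t. v *\<^sub>R (c * \<i> * cis t)) UNIV" for v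
      by (intro Ck_on_bounded_linear[OF bounded_linear_scaleR_right] Suc) auto
  qed
qed

lemma Cinf_on_cis: "Cinf_on cis UNIV"
  using Ck_on_cis[of _ 1] by (simp add: Cinf_on_def)

section \<open>Smooth permutations of Euclidean space\<close>

definition smooth_perm :: "('a::euclidean_space \<Rightarrow> 'a) \<Rightarrow> bool" where
  "smooth_perm f \<longleftrightarrow> bij f \<and> Cinf_on f UNIV \<and> Cinf_on (inv_into UNIV f) UNIV"

lemma smooth_permI:
  assumes "Cinf_on f UNIV" "Cinf_on g UNIV" "\<And>x. f (g x) = x" "\<And>x. g (f x) = x"
  shows "smooth_perm f" "inv_into UNIV f = g"
proof -
  show "inv_into UNIV f = g" using assms by (intro inv_unique_comp) auto
  moreover have "bij f" using assms by (intro o_bij[of g]) auto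
  ultimately show "smooth_perm f" using assms by (simp add: smooth_perm_def)
qed

lemma smooth_perm_id: "smooth_perm id"
  unfolding smooth_perm_def using Cinf_on_linear[OF bounded_linear_ident open_UNIV]
  by (simp add: id_def[abs_def] bij_id[unfolded id_def])

lemma smooth_perm_comp: "smooth_perm f \<Longrightarrow> smooth_perm g \<Longrightarrow> smooth_perm (f \<circ> g)"
  unfolding smooth_perm_def o_def[abs_def]
  by (auto intro: bij_comp[unfolded o_def[abs_def]] Cinf_on_compose[OF open_UNIV open_UNIV subset_UNIV]
      simp: o_inv_distrib[unfolded o_def[abs_def]])

lemma smooth_perm_inv: "smooth_perm f \<Longrightarrow> smooth_perm (inv_into UNIV f)"
  by (simp add: smooth_perm_def bij_imp_bij_inv inv_inv_eq)

lemma smooth_perm_bij: "smooth_perm f \<Longrightarrow> bij f"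
  by (simp add: smooth_perm_def)

lemma smooth_perm_continuous: "smooth_perm f \<Longrightarrow> continuous_on A f"
  unfolding smooth_perm_def by (meson Cinf_on_imp_continuous_on continuous_on_subset subset_UNIV)

section \<open>Twists\<close>

definition radial_rotation :: "(real \<Rightarrow> real) \<Rightarrow> complex \<Rightarrow> complex" where
  "radial_rotation h z = z * cis (h (norm z ^ 2))"

lemma radial_rotation_add:
  "radial_rotation h (radial_rotation g z) = radial_rotation (\<lambda>x. h x + g x) z"
  by (simp add: radial_rotation_def norm_mult cis_mult[symmetric] mult_ac)

lemma Cinf_on_radial_rotation:
  assumes "Cinf_on h UNIV"
  shows "Cinf_on (radial_rotation h) UNIV"
proof -
  have id: "Cinf_on (\<lambda>z::complex. z) UNIV"
    by (rule Cinf_on_linear[OF bounded_linear_ident open_UNIV])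
  have "Cinf_on (\<lambda>z::complex. z \<bullet> z) UNIV"
    by (rule Cinf_on_bilinear[OF bounded_bilinear_inner open_UNIV id id])
  then have "Cinf_on (\<lambda>z::complex. h (z \<bullet> z)) UNIV"
    by (rule Cinf_on_compose[OF open_UNIV open_UNIV subset_UNIV _ assms])
  then have "Cinf_on (\<lambda>z::complex. cis (h (z \<bullet> z))) UNIV"
    by (rule Cinf_on_compose[OF open_UNIV open_UNIV subset_UNIV _ Cinf_on_cis])
  then have "Cinf_on (\<lambda>z::complex. z * cis (h (z \<bullet> z))) UNIV"
    by (rule Cinf_on_bilinear[OF bounded_bilinear_mult open_UNIV id])
  then show ?thesis
    by (simp add: radial_rotation_def[abs_def] power2_norm_eq_inner)
qed

lemma smooth_perm_radial_rotation:
  assumes "Cinf_on h UNIV"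
  shows "smooth_perm (radial_rotation h)" "inv_into UNIV (radial_rotation h) = radial_rotation (\<lambda>x. - h x)"
proof -
  have n: "Cinf_on (\<lambda>x. - h x) UNIV"
    by (rule Cinf_on_compose[OF open_UNIV open_UNIV subset_UNIV assms])
      (intro Cinf_on_linear bounded_linear_minus bounded_linear_ident open_UNIV)
  have "radial_rotation h (radial_rotation (\<lambda>x. - h x) z) = z"
    "radial_rotation (\<lambda>x. - h x) (radial_rotation h z) = z" for z
    by (simp_all add: radial_rotation_add) (simp_all add: radial_rotation_def)
  then show "smooth_perm (radial_rotation h)" "inv_into UNIV (radial_rotation h) = radial_rotation (\<lambda>x. - h x)"
    using smooth_permI Cinf_on_radial_rotation[OF assms] Cinf_on_radial_rotation[OF n] by blast+
qed

text \<open>The angle is a multiple of \<open>2\<pi>\<close> on the inner side, so that the twist moves points of the annulus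
  only. Two full turns are used rather than one: a path crossing the annulus may itself turn by
  almost \<open>\<pi>\<close>, and enough has to remain after subtracting this.\<close>

definition twist_angle :: "real \<Rightarrow> real \<Rightarrow> real" where
  "twist_angle \<delta> x = 4 * pi * smooth_step (((1 + \<delta>)\<^sup>2 - x) / (4 * \<delta>))"

lemma Cinf_on_twist_angle: "Cinf_on (twist_angle \<delta>) UNIV"
proof -
  have "Cinf_on (\<lambda>x. (1 + \<delta>)\<^sup>2 / (4 * \<delta>) + (- 1 / (4 * \<delta>)) * x) UNIV"
    by (rule Cinf_on_affine[OF bounded_linear_mult_right])
  then have "Cinf_on (\<lambda>x. smooth_step ((1 + \<delta>)\<^sup>2 / (4 * \<delta>) + (- 1 / (4 * \<delta>)) * x)) UNIV"
    by (rule Cinf_on_compose[OF open_UNIV open_UNIV subset_UNIV _ Cinf_on_smooth_step])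
  then have "Cinf_on (\<lambda>x. (4 * pi) * smooth_step ((1 + \<delta>)\<^sup>2 / (4 * \<delta>) + (- 1 / (4 * \<delta>)) * x)) UNIV"
    by (rule Cinf_on_compose[OF open_UNIV open_UNIV subset_UNIV])
      (intro Cinf_on_linear bounded_linear_mult_right open_UNIV)
  then show ?thesis
    by (simp add: twist_angle_def[abs_def] diff_divide_distrib)
qed

lemma twist_angle_inner: "\<delta> > 0 \<Longrightarrow> x \<le> (1 - \<delta>)\<^sup>2 \<Longrightarrow> twist_angle \<delta> x = 4 * pi"
  unfolding twist_angle_def by (subst smooth_step_1) (auto simp: field_simps power2_eq_square)

lemma twist_angle_outer: "\<delta> > 0 \<Longrightarrow> x \<ge> (1 + \<delta>)\<^sup>2 \<Longrightarrow> twist_angle \<delta> x = 0"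
  unfolding twist_angle_def by (subst smooth_step_0) (auto simp: field_simps)

definition annulus :: "real \<Rightarrow> complex set" where
  "annulus \<delta> = {z. 1 - \<delta> \<le> norm z \<and> norm z \<le> 1 + \<delta>}"

definition twist :: "real \<Rightarrow> complex \<Rightarrow> complex" where
  "twist \<delta> = radial_rotation (twist_angle \<delta>)"

lemma smooth_perm_twist: "smooth_perm (twist \<delta>)"
  unfolding twist_def by (rule smooth_perm_radial_rotation[OF Cinf_on_twist_angle])

lemma twist_outside_annulus:
  assumes "0 < \<delta>" "\<delta> < 1" "z \<notin> annulus \<delta>"
  shows "twist \<delta> z = z"
proof -
  have "norm z < 1 - \<delta> \<or> 1 + \<delta> < norm z" using assms by (auto simp: annulus_def)
  then have "(norm z)\<^sup>2 \<le> (1 - \<delta>)\<^sup>2 \<or> (1 + \<delta>)\<^sup>2 \<le> (norm z)\<^sup>2"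
    using assms by (auto intro: power_mono)
  moreover have "cis (4 * pi) = 1"
    using cis_multiple_2pi[of 2] by (simp add: mult_ac)
  ultimately show ?thesis
    using twist_angle_inner[OF assms(1)] twist_angle_outer[OF assms(1)]
    by (auto simp: twist_def radial_rotation_def)
qed

section \<open>Evaluating words on permutations\<close>

primrec word_map :: "('v \<Rightarrow> 'a \<Rightarrow> 'a) \<Rightarrow> 'v word \<Rightarrow> 'a \<Rightarrow> 'a" where
  "word_map G [] = id"
| "word_map G (l # w) =
    (if snd l then G (fst l) else inv_into UNIV (G (fst l))) \<circ> word_map G w"

lemma word_map_append: "word_map G (u @ v) = word_map G u \<circ> word_map G v"
  by (induction u) (auto simp: o_assoc)

lemma word_map_cong:
  "(\<And>v. v \<in> S \<Longrightarrow> G v = H v) \<Longrightarrow> w \<in> words S \<Longrightarrow> word_map G w = word_map H w"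
  by (induction w) auto

lemma word_map_fixes:
  assumes "\<And>v. v \<in> S \<Longrightarrow> bij (G v)" "\<And>v. v \<in> S \<Longrightarrow> G v z = z" "w \<in> words S"
  shows "word_map G w z = z"
  using assms(3)
proof (induction w)
  case (Cons l w)
  then have "fst l \<in> S" by auto
  then have "inv_into UNIV (G (fst l)) z = z"
    using assms(1,2) by (metis bij_inv_eq_iff)
  then show ?case using Cons assms(2) \<open>fst l \<in> S\<close> by auto
qed auto

lemma smooth_perm_word_map:
  assumes "\<And>v. v \<in> S \<Longrightarrow> smooth_perm (G v)" "w \<in> words S"
  shows "smooth_perm (word_map G w)"
  using assms(2)
proof (induction w)
  case (Cons l w)
  then have "smooth_perm (G (fst l))" "smooth_perm (word_map G w)"
    using assms(1)[of "fst l"] by auto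
  then show ?case
    unfolding word_map.simps by (intro smooth_perm_comp) (auto intro: smooth_perm_inv)
qed (simp only: word_map.simps smooth_perm_id)

lemma word_map_semiconj:
  assumes "\<And>v. v \<in> S \<Longrightarrow> bij (G v)" "\<And>v. v \<in> S \<Longrightarrow> bij (H v)"
    "\<And>v z. v \<in> S \<Longrightarrow> z \<in> D \<Longrightarrow> G v (T z) = T (H v z)"
    "\<And>v. v \<in> S \<Longrightarrow> H v ` D = D" "w \<in> words S" "z \<in> D"
  shows "word_map G w (T z) = T (word_map H w z) \<and> word_map H w z \<in> D"
  using assms(5)
proof (induction w)
  case (Cons l w)
  let ?y = "word_map H w z" and ?v = "fst l"
  have v: "?v \<in> S" and y: "?y \<in> D" "word_map G w (T z) = T ?y" using Cons by auto
  have "H ?v ?y \<in> D" using assms(4)[OF v] y by blast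
  have "?y \<in> H ?v ` D" using assms(4)[OF v] y by simp
  then obtain x where x: "x \<in> D" "H ?v x = ?y" by (metis imageE)
  then have "inv_into UNIV (H ?v) ?y = x" using inv_f_f[OF bij_is_inj[OF assms(2)[OF v]], of x] by simp
  moreover have "inv_into UNIV (G ?v) (T ?y) = T x"
    using inv_f_f[OF bij_is_inj[OF assms(1)[OF v]], of "T x"] assms(3)[OF v x(1)] x(2) by simp
  ultimately show ?case using y x assms(3)[OF v y(1)] \<open>H ?v ?y \<in> D\<close> by simp
qed (use assms in simp)

lemma disjoint_supports_commute:
  assumes "inj f" "inj g" "\<And>z. f z = z \<or> g z = z"
  shows "f (g z) = g (f z)"
  by (metis assms injD)

text \<open>Commuting permutations satisfy the defining relators, so evaluation descends to the group.\<close>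

lemma (in raag_words) word_map_raag_eq:
  assumes "\<And>v. v \<in> V \<Longrightarrow> bij (G v)"
    "\<And>u v z. {u, v} \<in> E \<Longrightarrow> G u (G v z) = G v (G u z)"
    "u \<doteq> v"
  shows "word_map G u = word_map G v"
  using assms(3)
proof (induction rule: word_eq.induct)
  case (cancel u v s b)
  have "bij (G s)" using assms(1) cancel by simp
  then have "word_map G [(s, b), (s, \<not> b)] = id"
    by (cases b) (auto simp: fun_eq_iff bij_is_inj inv_f_f bij_is_surj surj_f_inv_f)
  then show ?case by (simp only: word_map_append id_o)
next
  case (relator u v r)
  then obtain x y where r: "r = commutator_word x y" "{x, y} \<in> E" by auto
  then have "x \<in> V" "y \<in> V" using relator by (auto simp: commutator_word_def)
  then have b: "bij (G x)" "bij (G y)" using assms(1) by auto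
  have "word_map G r z = z" for z
  proof -
    have "word_map G r z = G x (G y (inv_into UNIV (G x) (inv_into UNIV (G y) z)))"
      by (simp add: r commutator_word_def)
    also have "\<dots> = z"
      using b by (simp add: assms(2)[OF r(2)] bij_is_surj surj_f_inv_f)
    finally show ?thesis .
  qed
  then have "word_map G r = id" by auto
  then show ?case by (simp only: word_map_append id_o)
qed auto

section \<open>Paths crossing an annulus and paths sweeping around it\<close>

text \<open>The subinterval ends at the first time \<open>t'\<close> at which the far level is reached, and starts at the
  last time before \<open>t'\<close> at which the near level is attained.\<close>

lemma crossing_subinterval:
  fixes f :: "real \<Rightarrow> real"
  assumes "continuous_on {s..t} f" "s \<le> t" "a < b"
    "(f s \<le> a \<and> b \<le> f t) \<or> (b \<le> f s \<and> f t \<le> a)"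
  obtains s' t' where "s \<le> s'" "s' < t'" "t' \<le> t"
    "(f s' = a \<and> f t' = b) \<or> (f s' = b \<and> f t' = a)" "\<And>x. x \<in> {s'..t'} \<Longrightarrow> a \<le> f x \<and> f x \<le> b"
proof -
  have up: "\<exists>s' t'. s \<le> s' \<and> s' < t' \<and> t' \<le> t \<and> f s' = a \<and> f t' = b \<and> (\<forall>x\<in>{s'..t'}. a \<le> f x \<and> f x \<le> b)"
    if f: "continuous_on {s..t} f" "a < b" "f s \<le> a" "b \<le> f t" for f :: "real \<Rightarrow> real" and a b
  proof -
    have cl: "compact {x \<in> {u..v}. f x = c}" if "s \<le> u" "v \<le> t" for u v c
    proof -
      have "closed ({u..v} \<inter> f -` {c})"
        using that f(1) by (intro continuous_closed_preimage continuous_on_subset[OF f(1)]) auto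
      then have "compact ({u..v} \<inter> ({u..v} \<inter> f -` {c}))" by (intro compact_Int_closed) auto
      moreover have "{u..v} \<inter> ({u..v} \<inter> f -` {c}) = {x \<in> {u..v}. f x = c}" by auto
      ultimately show ?thesis by simp
    qed
    have ivt: "\<exists>x\<in>{u..v}. f x = c" if "s \<le> u" "u \<le> v" "v \<le> t" "f u \<le> c" "c \<le> f v" for u v c
      using IVT'[of f u c v] that continuous_on_subset[OF f(1), of "{u..v}"] by auto
    have "{x \<in> {s..t}. f x = b} \<noteq> {}" using ivt[of s t b] assms(2) f by auto
    then obtain t' where t': "t' \<in> {s..t}" "f t' = b" "\<And>x. x \<in> {s..t} \<Longrightarrow> f x = b \<Longrightarrow> t' \<le> x"
      using compact_attains_inf[OF cl[of s t b]] by auto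
    have "{x \<in> {s..t'}. f x = a} \<noteq> {}" using ivt[of s t' a] t' f by auto
    then obtain s' where s': "s' \<in> {s..t'}" "f s' = a" "\<And>x. x \<in> {s..t'} \<Longrightarrow> f x = a \<Longrightarrow> x \<le> s'"
      using compact_attains_sup[OF cl[of s t' a]] t' by auto
    have "s' \<noteq> t'" using s' t' f by auto
    moreover have "a \<le> f x \<and> f x \<le> b" if x: "x \<in> {s'..t'}" for x
    proof (intro conjI; rule ccontr)
      assume "\<not> a \<le> f x"
      then obtain y where y: "y \<in> {x..t'}" "f y = a" using ivt[of x t' a] x s' t' f by auto
      then have "y = x" using s'(3)[of y] s'(1) x by auto
      then show False using y \<open>\<not> a \<le> f x\<close> by auto
    next
      assume "\<not> f x \<le> b"
      then obtain y where y: "y \<in> {s'..x}" "f y = b" using ivt[of s' x b] x s' t' f by auto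
      then have "y = x" using t'(3)[of y] s'(1) t'(1) x by auto
      then show False using y \<open>\<not> f x \<le> b\<close> by auto
    qed
    ultimately show ?thesis using s' t' by (intro exI[of _ s'] exI[of _ t']) auto
  qed
  show ?thesis
  proof (cases "f s \<le> a \<and> b \<le> f t")
    case True
    then show ?thesis using up[OF assms(1,3)] that by blast
  next
    case False
    have "continuous_on {s..t} (\<lambda>x. - f x)" using assms(1) by (intro continuous_intros)
    then have "\<exists>s' t'. s \<le> s' \<and> s' < t' \<and> t' \<le> t \<and> - f s' = - b \<and> - f t' = - a \<and>
        (\<forall>x\<in>{s'..t'}. - b \<le> - f x \<and> - f x \<le> - a)"
      using up[of "\<lambda>x. - f x" "- b" "- a"] assms False by auto
    then obtain s' t' where "s \<le> s'" "s' < t'" "t' \<le> t" "f s' = b" "f t' = a"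
      "\<forall>x\<in>{s'..t'}. - b \<le> - f x \<and> - f x \<le> - a" by auto
    then show ?thesis using that[of s' t'] by auto
  qed
qed

text \<open>Ping-pong is played with paths instead of points. A crossing path joins the two boundary circles
  of the annulus; being confined to an open half plane through the origin, it cannot unwind
  a twist. The two directions of travel are not distinguished, since twists may be inverted.\<close>

definition crosses :: "real \<Rightarrow> (real \<Rightarrow> complex) \<Rightarrow> real \<Rightarrow> real \<Rightarrow> bool" where
  "crosses \<delta> \<gamma> s t \<longleftrightarrow> s < t \<and> continuous_on {s..t} \<gamma> \<and> \<gamma> ` {s..t} \<subseteq> annulus \<delta> \<and>
     (\<exists>\<omega>. \<omega> \<noteq> 0 \<and> (\<forall>x\<in>{s..t}. Re (\<gamma> x * \<omega>) > 0)) \<and>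
     ((norm (\<gamma> s) = 1 - \<delta> \<and> norm (\<gamma> t) = 1 + \<delta>) \<or> (norm (\<gamma> s) = 1 + \<delta> \<and> norm (\<gamma> t) = 1 - \<delta>))"

text \<open>A sweeping path goes around the annulus at least one and a half times, so that it passes
  completely through every half of the annulus.\<close>

definition sweeps :: "real \<Rightarrow> (real \<Rightarrow> complex) \<Rightarrow> real \<Rightarrow> real \<Rightarrow> bool" where
  "sweeps \<delta> \<gamma> s t \<longleftrightarrow> s < t \<and> continuous_on {s..t} \<gamma> \<and> \<gamma> ` {s..t} \<subseteq> annulus \<delta> \<and>
     (\<exists>\<theta>. continuous_on {s..t} \<theta> \<and> (\<forall>x\<in>{s..t}. \<gamma> x = norm (\<gamma> x) * cis (\<theta> x)) \<and>
       \<bar>\<theta> t - \<theta> s\<bar> \<ge> 3 * pi)"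

lemma crosses_cong:
  assumes "\<And>x. x \<in> {s..t} \<Longrightarrow> \<gamma> x = \<gamma>' x" "crosses \<delta> \<gamma> s t"
  shows "crosses \<delta> \<gamma>' s t"
proof -
  have "continuous_on {s..t} \<gamma>'"
    using assms(2) continuous_on_cong[OF HOL.refl, of "{s..t}" \<gamma> \<gamma>'] assms(1)
    unfolding crosses_def by blast
  moreover have "\<gamma>' ` {s..t} = \<gamma> ` {s..t}"
    using assms(1) by (intro image_cong) auto
  moreover have "\<gamma> s = \<gamma>' s" "\<gamma> t = \<gamma>' t" using assms by (auto simp: crosses_def)
  ultimately show ?thesis using assms by (auto simp: crosses_def)
qed

text \<open>An interval of length \<open>3\<pi>\<close> contains a translate of \<open>{x..x + L}\<close> by a multiple of \<open>2\<pi>\<close>.\<close>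

lemma sweeps_subarc:
  assumes "sweeps \<delta> \<gamma> s t" "0 < L" "L \<le> pi"
  obtains s' t' \<theta> where "s \<le> s'" "s' < t'" "t' \<le> t" 
    "\<And>y. y \<in> {s'..t'} \<Longrightarrow> \<gamma> y = norm (\<gamma> y) * cis (\<theta> y) \<and> x \<le> \<theta> y \<and> \<theta> y \<le> x + L"
    "(\<theta> s' = x \<and> \<theta> t' = x + L) \<or> (\<theta> s' = x + L \<and> \<theta> t' = x)"
proof -
  obtain \<theta> where \<theta>: "continuous_on {s..t} \<theta>" "\<And>x. x \<in> {s..t} \<Longrightarrow> \<gamma> x = norm (\<gamma> x) * cis (\<theta> x)"
    "\<bar>\<theta> t - \<theta> s\<bar> \<ge> 3 * pi" "s < t" using assms by (auto simp: sweeps_def)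
  define m where "m = min (\<theta> s) (\<theta> t)"
  define j where "j = \<lceil>(m - x) / (2 * pi)\<rceil>"
  have "(m - x) / (2 * pi) \<le> of_int j" "of_int j < (m - x) / (2 * pi) + 1"
    unfolding j_def by linarith+
  then have j: "m \<le> x + 2 * pi * of_int j" "x + 2 * pi * of_int j \<le> m + 2 * pi"
    by (auto simp: field_simps)
  let ?a = "x + 2 * pi * of_int j" and ?b = "x + 2 * pi * of_int j + L"
  have ends: "(\<theta> s \<le> ?a \<and> ?b \<le> \<theta> t) \<or> (?b \<le> \<theta> s \<and> \<theta> t \<le> ?a)"
    using j \<theta>(3) assms(3) unfolding m_def by (auto simp: abs_if min_def split: if_splits)
  obtain s' t' where st: "s \<le> s'" "s' < t'" "t' \<le> t"
    "(\<theta> s' = ?a \<and> \<theta> t' = ?b) \<or> (\<theta> s' = ?b \<and> \<theta> t' = ?a)" "\<And>x. x \<in> {s'..t'} \<Longrightarrow> ?a \<le> \<theta> x \<and> \<theta> x \<le> ?b"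
    using crossing_subinterval[OF \<theta>(1) _ _ ends] \<theta>(4) assms(2) by auto
  have c: "cis (\<theta> y - 2 * pi * of_int j) = cis (\<theta> y)" for y
  proof -
    have "cis (\<theta> y + 2 * pi * of_int (- j)) = cis (\<theta> y) * cis (2 * pi * of_int (- j))"
      by (simp only: cis_mult)
    also have "cis (2 * pi * of_int (- j)) = 1" by (rule cis_multiple_2pi) auto
    finally show ?thesis by simp
  qed
  show ?thesis
  proof (rule that[OF st(1-3), of "\<lambda>y. \<theta> y - 2 * pi * of_int j"])
    show "\<gamma> y = norm (\<gamma> y) * cis (\<theta> y - 2 * pi * of_int j) \<and> x \<le> \<theta> y - 2 * pi * of_int j \<and>
        \<theta> y - 2 * pi * of_int j \<le> x + L" if "y \<in> {s'..t'}" for y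
      using \<theta>(2)[of y] st(5)[OF that] st(1,3) that unfolding c by auto
  qed (use st(4) in auto)
qed

lemma word_map_twist:
  assumes "X b = twist \<delta>" "B \<in> words {b}"
  shows "word_map X B z = z * cis (of_int (exponent_sum B) * twist_angle \<delta> ((norm z)\<^sup>2))"
  using assms(2)
proof (induction B arbitrary: z)
  case Nil
  then show ?case by simp
next
  case (Cons l B)
  let ?a = "\<lambda>z. twist_angle \<delta> ((norm z)\<^sup>2)"
  have "fst l = b" using Cons by auto
  then have "word_map X (l # B) z = word_map X B z * cis ((if snd l then 1 else - 1) * ?a (word_map X B z))"
    using assms(1) smooth_perm_radial_rotation(2)[OF Cinf_on_twist_angle]
    by (auto simp: twist_def radial_rotation_def)
  moreover have "norm (word_map X B z) = norm z" using Cons by (simp add: norm_mult)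
  ultimately have "word_map X (l # B) z =
      z * (cis (of_int (exponent_sum B) * ?a z) * cis ((if snd l then 1 else - 1) * ?a z))"
    using Cons by (simp add: mult_ac)
  then show ?case by (simp add: cis_mult algebra_simps)
qed

lemma abs_Arg_less_pi_half:
  assumes "Re z > 0"
  shows "\<bar>Arg z\<bar> < pi / 2"
proof -
  have "z \<noteq> 0" using assms by auto
  then show ?thesis using assms by (metis Re_Ln_pos_lt Arg_eq_Im_Ln)
qed

text \<open>The two ends of a crossing path are turned by angles that differ by at least \<open>4\<pi>\<close>, while the angle
  along the path itself, measured within a half plane, varies by less than \<open>\<pi>\<close>.\<close>

lemma crosses_imp_twist_sweeps:
  assumes "crosses \<delta> \<gamma> s t" "0 < \<delta>" "\<delta> < 1" "X b = twist \<delta>" "B \<in> words {b}"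
    "exponent_sum B \<noteq> 0"
  shows "sweeps \<delta> (word_map X B \<circ> \<gamma>) s t"
proof -
  let ?n = "exponent_sum B"
  obtain \<omega> where \<gamma>: "s < t" "continuous_on {s..t} \<gamma>" "\<gamma> ` {s..t} \<subseteq> annulus \<delta>"
    "\<omega> \<noteq> 0" "\<And>x. x \<in> {s..t} \<Longrightarrow> Re (\<gamma> x * \<omega>) > 0"
    "(norm (\<gamma> s) = 1 - \<delta> \<and> norm (\<gamma> t) = 1 + \<delta>) \<or> (norm (\<gamma> s) = 1 + \<delta> \<and> norm (\<gamma> t) = 1 - \<delta>)"
    using assms by (auto simp: crosses_def)
  have W: "word_map X B z = z * cis (?n * twist_angle \<delta> ((norm z)\<^sup>2))" for z
    using word_map_twist[of X b \<delta> B z] assms(4,5) by simp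
  then have N: "norm (word_map X B z) = norm z" for z by (simp add: norm_mult)
  have cw: "continuous_on A (word_map X B)" for A
    using smooth_perm_word_map[of "{b}" X B] assms(4,5) smooth_perm_twist smooth_perm_continuous
    by force
  (* the argument relative to the axis of the half plane is a continuous angle along the path *)
  define \<theta>0 where "\<theta>0 x = Arg (\<gamma> x * \<omega>) - Arg \<omega>" for x
  define \<theta> where "\<theta> x = \<theta>0 x + ?n * twist_angle \<delta> ((norm (\<gamma> x))\<^sup>2)" for x
  have arg: "\<bar>Arg (\<gamma> x * \<omega>)\<bar> < pi / 2" if "x \<in> {s..t}" for x
    using \<gamma>(5)[OF that] by (rule abs_Arg_less_pi_half)
  have "continuous_on {s..t} (\<lambda>x. Arg (\<gamma> x * \<omega>))"
  proof (rule continuous_on_compose2[of "{z. Re z > 0}" Arg])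
    show "continuous_on {z. Re z > 0} Arg"
      by (intro continuous_at_imp_continuous_on ballI continuous_at_Arg)
        (auto simp: complex_nonpos_Reals_iff)
    show "continuous_on {s..t} (\<lambda>x. \<gamma> x * \<omega>)" using \<gamma>(2) by (intro continuous_intros)
  qed (use \<gamma>(5) in auto)
  moreover have "continuous_on {s..t} (\<lambda>x. twist_angle \<delta> ((norm (\<gamma> x))\<^sup>2))"
    by (rule continuous_on_compose2[OF Cinf_on_imp_continuous_on[OF Cinf_on_twist_angle]])
      (auto intro!: continuous_intros \<gamma>(2))
  ultimately have c\<theta>: "continuous_on {s..t} \<theta>"
    unfolding \<theta>_def[abs_def] \<theta>0_def
    by (intro continuous_on_add continuous_on_diff continuous_on_mult continuous_on_const)
  have polar: "\<gamma> x = norm (\<gamma> x) * cis (\<theta>0 x)" if "x \<in> {s..t}" for x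
  proof -
    have "\<gamma> x * \<omega> \<noteq> 0" using \<gamma>(5)[OF that] by auto
    then have "\<gamma> x * \<omega> = norm (\<gamma> x * \<omega>) * cis (Arg (\<gamma> x * \<omega>))" "\<omega> = norm \<omega> * cis (Arg \<omega>)"
      using rcis_cmod_Arg[symmetric] unfolding rcis_def by blast+
    then have "\<gamma> x * \<omega> / \<omega> = norm (\<gamma> x * \<omega>) * cis (Arg (\<gamma> x * \<omega>)) / (norm \<omega> * cis (Arg \<omega>))"
      by metis
    also have "\<dots> = norm (\<gamma> x) * (cis (Arg (\<gamma> x * \<omega>)) / cis (Arg \<omega>))"
      using \<gamma>(4) by (simp add: norm_mult)
    finally show ?thesis using \<gamma>(4) by (simp add: \<theta>0_def cis_divide)
  qed
  have "(word_map X B \<circ> \<gamma>) x = norm ((word_map X B \<circ> \<gamma>) x) * cis (\<theta> x)" if "x \<in> {s..t}" for x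
  proof -
    have "word_map X B (\<gamma> x) = norm (\<gamma> x) * cis (\<theta>0 x) * cis (?n * twist_angle \<delta> ((norm (\<gamma> x))\<^sup>2))"
      unfolding W by (simp only: polar[OF that, symmetric])
    then have "word_map X B (\<gamma> x) = norm (\<gamma> x) * cis (\<theta> x)"
      by (simp add: \<theta>_def cis_mult[symmetric] mult.assoc)
    then show ?thesis unfolding o_apply N .
  qed
  moreover have "\<bar>\<theta> t - \<theta> s\<bar> \<ge> 3 * pi"
  proof -
    define D where "D = ?n * (twist_angle \<delta> ((norm (\<gamma> t))\<^sup>2) - twist_angle \<delta> ((norm (\<gamma> s))\<^sup>2))"
    have "twist_angle \<delta> ((norm (\<gamma> t))\<^sup>2) - twist_angle \<delta> ((norm (\<gamma> s))\<^sup>2) \<in> {4 * pi, - 4 * pi}"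
      using \<gamma>(6) twist_angle_inner[OF assms(2)] twist_angle_outer[OF assms(2)] by auto
    then have "\<bar>D\<bar> = \<bar>real_of_int ?n\<bar> * (4 * pi)"
      by (auto simp: D_def abs_mult)
    moreover have "\<bar>real_of_int ?n\<bar> \<ge> 1" using assms(6) by linarith
    ultimately have "\<bar>D\<bar> \<ge> 4 * pi" using mult_right_mono[of 1 _ "4 * pi"] by simp
    moreover have "\<theta> t - \<theta> s = (Arg (\<gamma> t * \<omega>) - Arg (\<gamma> s * \<omega>)) + D"
      by (simp add: \<theta>_def \<theta>0_def D_def algebra_simps)
    moreover have "\<bar>Arg (\<gamma> s * \<omega>)\<bar> < pi / 2" "\<bar>Arg (\<gamma> t * \<omega>)\<bar> < pi / 2"
      using arg[of s] arg[of t] \<gamma>(1) by auto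
    ultimately show ?thesis by linarith
  qed
  moreover have "continuous_on {s..t} (word_map X B \<circ> \<gamma>)"
    using \<gamma>(2) cw by (rule continuous_on_compose)
  moreover have "(word_map X B \<circ> \<gamma>) ` {s..t} \<subseteq> annulus \<delta>"
    using \<gamma>(3) N by (auto simp: annulus_def)
  ultimately show ?thesis using \<gamma>(1) c\<theta> unfolding sweeps_def by blast
qed

section \<open>A tree of annuli\<close>

text \<open>Seen from a fixed annulus around the unit circle, \<open>q b\<close> is the centre and \<open>\<mu>\<close> the radius of the
  core circle of the child annulus labelled \<open>b\<close>, and \<open>\<delta>\<close> is the half-width of the fixed annulus,
  which has to be small compared with \<open>\<mu>\<close> for the child to look large next to it. The distances
  between the centres keep the children apart, and the bound on \<open>Im (q b)\<close> keeps
  them away from the parent of the fixed annulus.\<close>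

locale annulus_tree = raag_words V E
  for V :: "'v set" and E :: "'v set set" +
  fixes vs :: "'v list" and q :: "'v \<Rightarrow> complex" and \<mu> \<delta> :: real
  assumes vs: "set vs = V" "distinct vs"
    and lam: "0 < \<mu>" "\<mu> \<le> 1 / 20" and delta: "\<delta> = \<mu> / 40"
    and norm_q: "\<And>b. b \<in> V \<Longrightarrow> norm (q b) = 1" and Im_q: "\<And>b. b \<in> V \<Longrightarrow> Im (q b) \<ge> 4 / 5"
    and dist_q: "\<And>b c. b \<in> V \<Longrightarrow> c \<in> V \<Longrightarrow> b \<noteq> c \<Longrightarrow> dist (q b) (q c) \<ge> 4 * \<mu>"
begin

lemma delta_bounds: "0 < \<delta>" "\<delta> < 1" "\<delta> \<le> 1 / 800"
  using lam delta by auto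

text \<open>This similarity maps the unit circle to the core circle of the child annulus. Because of the factor
  \<open>\<i>\<close>, the real axis is mapped to the tangent of the unit circle at \<open>q b\<close>: in the coordinates of the
  child, its parent looks like a thin strip along the real axis.\<close>

definition place :: "'v \<Rightarrow> complex \<Rightarrow> complex" where
  "place b z = q b * (1 + \<i> * of_real \<mu> * z)"

definition unplace :: "'v \<Rightarrow> complex \<Rightarrow> complex" where
  "unplace b w = (w * cnj (q b) - 1) / (\<i> * of_real \<mu>)"

lemma q_cnj: "b \<in> V \<Longrightarrow> q b * cnj (q b) = 1"
  using norm_q[of b] by (simp add: complex_norm_square[symmetric])

lemma place_unplace:
  assumes "b \<in> V"
  shows "place b (unplace b w) = w"
proof -
  have "\<i> * of_real \<mu> * unplace b w = w * cnj (q b) - 1"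
    using lam by (simp add: unplace_def)
  then have "place b (unplace b w) = w * (q b * cnj (q b))"
    by (simp add: place_def)
  then show ?thesis using q_cnj[OF assms] by simp
qed

lemma unplace_place:
  assumes "b \<in> V"
  shows "unplace b (place b z) = z"
proof -
  have "place b z * cnj (q b) = (q b * cnj (q b)) * (1 + \<i> * of_real \<mu> * z)"
    by (simp add: place_def mult_ac)
  then show ?thesis using q_cnj[OF assms] lam by (simp add: unplace_def)
qed

lemma smooth_perm_place:
  assumes "b \<in> V"
  shows "smooth_perm (place b)" "smooth_perm (unplace b)"
proof -
  have "place b = (\<lambda>z. q b + (q b * \<i> * of_real \<mu>) * z)"
    by (simp add: place_def fun_eq_iff algebra_simps)
  then have p: "Cinf_on (place b) UNIV"
    by (simp add: Cinf_on_affine[OF bounded_linear_mult_right])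
  have "unplace b = (\<lambda>w. - (1 / (\<i> * of_real \<mu>)) + (cnj (q b) / (\<i> * of_real \<mu>)) * w)"
    by (simp add: unplace_def fun_eq_iff diff_divide_distrib mult.commute)
  then have u: "Cinf_on (unplace b) UNIV"
    by (simp only: Cinf_on_affine[OF bounded_linear_mult_right])
  show "smooth_perm (place b)"
    by (rule smooth_permI(1)[OF p u]) (simp_all add: place_unplace unplace_place assms)
  show "smooth_perm (unplace b)"
    by (rule smooth_permI(1)[OF u p]) (simp_all add: place_unplace unplace_place assms)
qed

definition disc :: "'v \<Rightarrow> complex set" where
  "disc b = place b ` ball 0 2"

lemma disc_iff: "b \<in> V \<Longrightarrow> w \<in> disc b \<longleftrightarrow> norm (unplace b w) < 2"
  unfolding disc_def by (metis (no_types, lifting) image_iff mem_ball_0 place_unplace unplace_place)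

lemma disc_dist:
  assumes "b \<in> V" "w \<in> disc b"
  shows "dist w (q b) < 2 * \<mu>"
proof -
  obtain z where z: "norm z < 2" "w = place b z" using assms by (auto simp: disc_def)
  have "w - q b = q b * \<i> * of_real \<mu> * z" by (simp add: z place_def algebra_simps)
  then have "dist w (q b) = \<mu> * norm z"
    using norm_q[OF assms(1)] lam by (simp add: dist_norm norm_mult)
  then show ?thesis using z lam by simp
qed

lemma disc_disjoint:
  assumes "b \<in> V" "c \<in> V" "b \<noteq> c"
  shows "disc b \<inter> disc c = {}"
proof -
  have "dist (q b) (q c) < 4 * \<mu>" if "w \<in> disc b" "w \<in> disc c" for w
    using disc_dist[OF assms(1) that(1)] disc_dist[OF assms(2) that(2)]
      dist_triangle3[of "q b" "q c" w] by (simp add: dist_commute)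
  then show ?thesis using dist_q[OF assms] by fastforce
qed

lemma disc_norm: 
  assumes "b \<in> V" "w \<in> disc b"
  shows "norm w < 2"
proof -
  have "norm w \<le> norm (q b) + dist w (q b)"
    by (metis dist_norm norm_triangle_sub)
  then show ?thesis using disc_dist[OF assms] norm_q[OF assms(1)] lam by simp
qed

text \<open>In the coordinates of an annulus, its children and everything below them lie above the line
  \<open>Im w = 1 / 2\<close>, and by the lemma \<open>annulus_in_disc\<close> its parent lies below this line. So the only
  annuli that meet are a parent and one of its children.\<close>

lemma disc_Im: 
  assumes "b \<in> V" "w \<in> disc b"
  shows "Im w > 1 / 2"
proof -
  have "\<bar>Im (w - q b)\<bar> \<le> dist w (q b)" by (metis abs_Im_le_cmod dist_norm)
  then show ?thesis using disc_dist[OF assms] Im_q[OF assms(1)] lam by (simp add: abs_le_iff)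
qed

lemma norm_place:
  assumes "b \<in> V"
  shows "(norm (place b z))\<^sup>2 = 1 - 2 * \<mu> * Im z + \<mu>\<^sup>2 * (norm z)\<^sup>2"
proof -
  have "(norm (place b z))\<^sup>2 = (norm (1 + \<i> * of_real \<mu> * z))\<^sup>2"
    using norm_q[OF assms] by (simp add: place_def norm_mult)
  also have "\<dots> = 1 - 2 * \<mu> * Im z + \<mu>\<^sup>2 * (norm z)\<^sup>2"
    unfolding cmod_power2 by (simp add: power2_eq_square algebra_simps)
  finally show ?thesis .
qed

lemma annulus_in_disc:
  assumes "b \<in> V" "norm z < 2" "place b z \<in> annulus \<delta>"
  shows "Im z \<le> 1 / 2"
proof -
  have "(1 - \<delta>)\<^sup>2 \<le> (norm (place b z))\<^sup>2"
    using assms(3) delta_bounds by (intro power_mono) (auto simp: annulus_def)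
  moreover have "1 - 2 * \<delta> \<le> (1 - \<delta>)\<^sup>2" by (simp add: power2_eq_square algebra_simps)
  ultimately have "1 - 2 * \<delta> \<le> 1 - 2 * \<mu> * Im z + \<mu>\<^sup>2 * (norm z)\<^sup>2"
    unfolding norm_place[OF assms(1)] by linarith
  moreover have "(norm z)\<^sup>2 \<le> 2\<^sup>2" using assms(2) by (intro power_mono) auto
  then have "\<mu>\<^sup>2 * (norm z)\<^sup>2 \<le> \<mu>\<^sup>2 * 4" by (intro mult_left_mono) auto
  moreover have "\<mu>\<^sup>2 * 4 \<le> \<mu> * (1 / 5)"
    using lam by (simp add: power2_eq_square)
  ultimately have "\<mu> * (2 * Im z) \<le> \<mu> * (1 / 20 + 1 / 5)"
    using delta by (simp add: algebra_simps)
  then show ?thesis using lam by (simp only: mult_le_cancel_left_pos)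
qed

definition nonadj :: "'v \<Rightarrow> 'v set" where
  "nonadj b = {u \<in> V. u \<noteq> b \<and> {u, b} \<notin> E}"

text \<open>The action of the generator \<open>v\<close> by all the annuli labelled \<open>v\<close> in the top \<open>k\<close> levels below a root
  annulus whose children are labelled by \<open>N\<close>. The children of an annulus labelled \<open>b\<close> carry the labels that do
  not commute with \<open>b\<close>. The root annulus itself carries no twist.\<close>

primrec tree_map :: "nat \<Rightarrow> 'v set \<Rightarrow> 'v \<Rightarrow> complex \<Rightarrow> complex" where
  "tree_map 0 N v = id"
| "tree_map (Suc k) N v = foldr (\<lambda>b. place b \<circ>
     (if v = b then twist \<delta> else tree_map k (nonadj b) v) \<circ> unplace b) (filter (\<lambda>b. b \<in> N) vs)"

declare tree_map.simps(2) [simp del]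

definition child_map :: "nat \<Rightarrow> 'v \<Rightarrow> 'v \<Rightarrow> complex \<Rightarrow> complex" where
  "child_map k b v = (if v = b then twist \<delta> else tree_map k (nonadj b) v)"

lemma foldr_disjoint_supports:
  assumes "distinct bs" "\<And>b z. b \<in> set bs \<Longrightarrow> z \<notin> D b \<Longrightarrow> f b z = z"
    "\<And>b z. b \<in> set bs \<Longrightarrow> z \<in> D b \<Longrightarrow> f b z \<in> D b"
    "\<And>b c. b \<in> set bs \<Longrightarrow> c \<in> set bs \<Longrightarrow> b \<noteq> c \<Longrightarrow> D b \<inter> D c = {}"
  shows "(\<forall>b\<in>set bs. \<forall>z\<in>D b. foldr f bs z = f b z) \<and>
    (\<forall>z. (\<forall>b\<in>set bs. z \<notin> D b) \<longrightarrow> foldr f bs z = z)"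
  using assms
proof (induction bs)
  case (Cons c bs)
  let ?F = "foldr f bs"
  have IH: "\<And>b z. b \<in> set bs \<Longrightarrow> z \<in> D b \<Longrightarrow> ?F z = f b z"
    "\<And>z. (\<forall>b\<in>set bs. z \<notin> D b) \<Longrightarrow> ?F z = z"
    using Cons.IH Cons.prems by auto
  have F: "foldr f (c # bs) z = f c (?F z)" for z by simp
  show ?case
    unfolding F
  proof (intro conjI ballI allI impI)
    fix b z assume b: "b \<in> set (c # bs)" "z \<in> D b"
    show "f c (?F z) = f b z"
    proof (cases "b = c")
      case True
      have "z \<notin> D b'" if "b' \<in> set bs" for b'
        using Cons.prems(1) Cons.prems(4)[of b' c] that True b by auto
      then show ?thesis using IH(2) True by simp
    next
      case False
      then have "f b z \<in> D b" "?F z = f b z" using IH(1) b Cons.prems(3) by auto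
      moreover have "f b z \<notin> D c" using Cons.prems(4)[of b c] b False \<open>f b z \<in> D b\<close> by auto
      ultimately show ?thesis using Cons.prems(2) by simp
    qed
  next
    fix z assume "\<forall>b\<in>set (c # bs). z \<notin> D b"
    then show "f c (?F z) = z" using IH(2) Cons.prems(2) by simp
  qed
qed auto

lemma supported_image:
  assumes "bij f" "\<And>z. z \<notin> A \<Longrightarrow> f z = z"
  shows "f ` A = A"
proof -
  have *: "f z \<in> A" if "z \<in> A" for z
    using that assms by (metis bij_is_inj injD)
  moreover have "z \<in> f ` A" if "z \<in> A" for z
  proof -
    obtain y where "z = f y" using assms(1) by (meson bij_pointE)
    then show ?thesis using that assms(2)[of y] by (cases "y \<in> A") auto
  qed
  ultimately show ?thesis by auto
qed

lemma smooth_perm_foldr: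
  "(\<And>b. b \<in> set bs \<Longrightarrow> smooth_perm (f b)) \<Longrightarrow> smooth_perm (foldr f bs)"
proof (induction bs)
  case (Cons b bs)
  then show ?case by (simp only: foldr_Cons smooth_perm_comp list.set_intros)
qed (simp only: foldr_Nil smooth_perm_id)

lemma twist_fixes: "z \<notin> annulus \<delta> \<Longrightarrow> twist \<delta> z = z"
  using twist_outside_annulus delta_bounds by blast

lemma annulus_norm: "z \<in> annulus \<delta> \<Longrightarrow> norm z < 2"
  using delta_bounds by (auto simp: annulus_def)

lemma smooth_perm_tree_map: "smooth_perm (tree_map k N v)"
proof (induction k arbitrary: N)
  case 0
  show ?case by (simp only: tree_map.simps smooth_perm_id)
next
  case (Suc k)
  show ?case
    unfolding tree_map.simps
  proof (rule smooth_perm_foldr)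
    fix b assume "b \<in> set (filter (\<lambda>b. b \<in> N) vs)"
    then have "b \<in> V" using vs by auto
    then show "smooth_perm (place b \<circ> (if v = b then twist \<delta> else tree_map k (nonadj b) v) \<circ> unplace b)"
      using smooth_perm_place smooth_perm_twist Suc by (intro smooth_perm_comp) auto
  qed
qed

lemma smooth_perm_child_map: "smooth_perm (child_map k b v)"
  by (simp add: child_map_def smooth_perm_twist smooth_perm_tree_map)

lemma tree_map_cases:
  assumes "\<And>N z. norm z \<ge> 2 \<Longrightarrow> tree_map k N v z = z"
  shows "b \<in> N \<Longrightarrow> b \<in> V \<Longrightarrow> norm z < 2 \<Longrightarrow> tree_map (Suc k) N v (place b z) = place b (child_map k b v z)"
    and "(\<And>b. b \<in> N \<Longrightarrow> b \<in> V \<Longrightarrow> z \<notin> disc b) \<Longrightarrow> tree_map (Suc k) N v z = z"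
proof -
  let ?bs = "filter (\<lambda>b. b \<in> N) vs" and ?f = "\<lambda>b. place b \<circ> child_map k b v \<circ> unplace b"
  have out: "child_map k b v z = z" if "norm z \<ge> 2" for b z
    using assms that twist_fixes[of z] annulus_norm[of z] by (auto simp: child_map_def)
  have inn: "norm (child_map k b v z) < 2" if "norm z < 2" for b z
    using supported_image[OF smooth_perm_bij[OF smooth_perm_child_map], of "ball 0 2" k b v] out that
    by (auto simp: not_less)
  have *: "(\<forall>b\<in>set ?bs. \<forall>z\<in>disc b. foldr ?f ?bs z = ?f b z) \<and>
    (\<forall>z. (\<forall>b\<in>set ?bs. z \<notin> disc b) \<longrightarrow> foldr ?f ?bs z = z)"
  proof (rule foldr_disjoint_supports)
    show "distinct ?bs" using vs by simp
    fix b assume b: "b \<in> set ?bs"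
    then have bV: "b \<in> V" using vs by auto
    show "?f b z = z" if "z \<notin> disc b" for z
      using that out[of "unplace b z" b] bV by (simp add: disc_iff place_unplace)
    show "?f b z \<in> disc b" if "z \<in> disc b" for z
      using that inn[of "unplace b z" b] bV by (simp add: disc_iff unplace_place)
    show "disc b \<inter> disc c = {}" if "c \<in> set ?bs" "b \<noteq> c" for c
      using that bV vs by (intro disc_disjoint) auto
  qed
  have t: "tree_map (Suc k) N v = foldr ?f ?bs"
    by (simp only: tree_map.simps child_map_def)
  show "tree_map (Suc k) N v (place b z) = place b (child_map k b v z)"
    if "b \<in> N" "b \<in> V" "norm z < 2"
  proof -
    have "place b z \<in> disc b" "b \<in> set ?bs" using that vs by (auto simp: disc_def)
    then show ?thesis unfolding t using * that by (simp add: unplace_place)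
  qed
  show "tree_map (Suc k) N v z = z" if "\<And>b. b \<in> N \<Longrightarrow> b \<in> V \<Longrightarrow> z \<notin> disc b"
    unfolding t using * that vs by simp
qed

lemma tree_map_norm: "norm z \<ge> 2 \<Longrightarrow> tree_map k N v z = z"
proof (induction k arbitrary: N z)
  case (Suc k)
  show ?case
  proof (rule tree_map_cases(2))
    show "tree_map k N v z = z" if "norm z \<ge> 2" for N z using Suc.IH that .
    show "z \<notin> disc b" if "b \<in> V" for b using disc_norm[OF that] Suc.prems by force
  qed
qed simp

lemma tree_map_place:
  "b \<in> N \<Longrightarrow> b \<in> V \<Longrightarrow> norm z < 2 \<Longrightarrow> tree_map (Suc k) N v (place b z) = place b (child_map k b v z)"
  by (rule tree_map_cases(1)) (simp_all add: tree_map_norm)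

lemma tree_map_outside:
  "(\<And>b. b \<in> N \<Longrightarrow> b \<in> V \<Longrightarrow> z \<notin> disc b) \<Longrightarrow> tree_map (Suc k) N v z = z"
  by (rule tree_map_cases(2)) (simp_all add: tree_map_norm)

lemma tree_map_Im: "Im z \<le> 1 / 2 \<Longrightarrow> tree_map k N v z = z"
  using tree_map_outside[of N z] disc_Im[of _ z] by (cases k) force+

text \<open>A child crossing the root annulus is labelled by an element of \<open>N\<close>, hence not by \<open>v\<close>, and the deeper
  annuli do not reach the root annulus.\<close>

lemma tree_map_annulus:
  assumes "v \<notin> N" "z \<in> annulus \<delta>"
  shows "tree_map k N v z = z"
proof (cases k)
  case (Suc j)
  show ?thesis
  proof (cases "\<exists>b\<in>N \<inter> V. z \<in> disc b")
    case True
    then obtain b z' where b: "b \<in> N" "b \<in> V" "norm z' < 2" "z = place b z'"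
      by (auto simp: disc_def)
    have "Im z' \<le> 1 / 2" using annulus_in_disc b assms by blast
    then show ?thesis
      using tree_map_place[OF b(1-3)] b assms by (auto simp: Suc child_map_def tree_map_Im)
  qed (auto simp: Suc intro!: tree_map_outside)
qed simp

lemma child_map_Im:
  assumes "v \<noteq> b" "Im z \<le> 1 / 2"
  shows "child_map k b v z = z"
  using assms by (simp add: child_map_def tree_map_Im)

text \<open>Annuli with adjacent labels are disjoint, because an annulus meets only its parent and its
  children, and the labels of parent and child are not adjacent.\<close>

lemma tree_map_disjoint_supports:
  assumes "{u, v} \<in> E"
  shows "tree_map k N u z = z \<or> tree_map k N v z = z"
proof (induction k arbitrary: N z)
  case (Suc k)
  have uv: "u \<noteq> v" using assms edge_neq by simp
  show ?case
  proof (cases "\<exists>b\<in>N \<inter> V. z \<in> disc b")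
    case True
    then obtain b z' where b: "b \<in> N" "b \<in> V" "norm z' < 2" "z = place b z'"
      by (auto simp: disc_def)
    have "child_map k b u z' = z' \<or> child_map k b v z' = z'"
    proof (cases "u = b \<or> v = b")
      case False
      then show ?thesis using Suc.IH by (auto simp: child_map_def)
    next
      case True
      then have "u \<notin> nonadj b" "v \<notin> nonadj b"
        using assms by (auto simp: nonadj_def insert_commute)
      then show ?thesis
        using True uv twist_fixes[of z'] tree_map_annulus[of _ "nonadj b" z' k]
        by (auto simp: child_map_def)
    qed
    then show ?thesis using tree_map_place[OF b(1-3)] b by auto
  qed (auto intro!: tree_map_outside)
qed simp

lemma tree_map_commute:
  assumes "{u, v} \<in> E"
  shows "tree_map k N u (tree_map k N v z) = tree_map k N v (tree_map k N u z)"
  using tree_map_disjoint_supports[OF assms] smooth_perm_tree_map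
  by (intro disjoint_supports_commute) (auto simp: smooth_perm_def bij_is_inj)

lemma word_map_tree_map_eq: "u \<doteq> v \<Longrightarrow> word_map (tree_map k N) u = word_map (tree_map k N) v"
  by (rule word_map_raag_eq[OF smooth_perm_bij[OF smooth_perm_tree_map] tree_map_commute])

lemma word_map_place:
  assumes "b \<in> N" "b \<in> V" "norm z < 2"
  shows "word_map (tree_map (Suc k) N) w (place b z) = place b (word_map (child_map k b) w z)"
proof -
  have im: "child_map k b v ` ball 0 2 = ball 0 2" for v
    using tree_map_norm twist_fixes annulus_norm
    by (intro supported_image smooth_perm_bij smooth_perm_child_map)
      (force simp: child_map_def not_less)
  show ?thesis
    using word_map_semiconj[of UNIV "tree_map (Suc k) N" "child_map k b" "ball 0 2" "place b" w z]
      assms im tree_map_place[OF assms(1,2)]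
    by (auto simp: smooth_perm_bij smooth_perm_tree_map smooth_perm_child_map)
qed

end

section \<open>Faithfulness\<close>

context annulus_tree
begin

text \<open>The points of the root annulus in the direction of \<open>q b\<close> lie inside the inner circle of the child
  labelled \<open>b\<close>, and those in the direction of \<open>\<i> q b\<close> lie outside its outer circle. A sweeping path
  passes from one direction to the other through the quarter between them, which the child
  annulus meets in its right half only.\<close>

lemma enter_child:
  assumes "sweeps \<delta> \<gamma> s t" "b \<in> V"
  obtains s' t' where "s \<le> s'" "s' < t'" "t' \<le> t" "crosses \<delta> (unplace b \<circ> \<gamma>) s' t'"
    "\<And>x. x \<in> {s'..t'} \<Longrightarrow> Im (unplace b (\<gamma> x)) \<le> 1 / 2"
proof -
  define \<alpha> where "\<alpha> = Arg (q b)"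
  have q: "q b = cis \<alpha>"
    using rcis_cmod_Arg[of "q b"] norm_q[OF assms(2)] by (simp add: \<alpha>_def rcis_def)
  have \<gamma>: "continuous_on {s..t} \<gamma>" "\<And>x. x \<in> {s..t} \<Longrightarrow> \<gamma> x \<in> annulus \<delta>"
    using assms by (auto simp: sweeps_def)
  obtain u v \<theta> where uv: "s \<le> u" "u < v" "v \<le> t"
    "\<And>y. y \<in> {u..v} \<Longrightarrow> \<gamma> y = norm (\<gamma> y) * cis (\<theta> y) \<and> \<alpha> \<le> \<theta> y \<and> \<theta> y \<le> \<alpha> + pi / 2"
    "(\<theta> u = \<alpha> \<and> \<theta> v = \<alpha> + pi / 2) \<or> (\<theta> u = \<alpha> + pi / 2 \<and> \<theta> v = \<alpha>)"
    using sweeps_subarc[OF assms(1), of "pi / 2" \<alpha>] by auto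
  define f where "f y = unplace b (\<gamma> y)" for y
  have f: "f y = (norm (\<gamma> y) * cis (\<theta> y - \<alpha>) - 1) / (\<i> * of_real \<mu>)" if "y \<in> {u..v}" for y
  proof -
    have "\<gamma> y * cnj (q b) = norm (\<gamma> y) * (cis (\<theta> y) * cis (- \<alpha>))"
      using uv(4)[OF that] by (simp add: q cis_cnj mult.assoc)
    then show ?thesis by (simp add: f_def unplace_def cis_mult)
  qed
  have Re_f: "Re (f y) = norm (\<gamma> y) * sin (\<theta> y - \<alpha>) / \<mu>" if "y \<in> {u..v}" for y
    unfolding f[OF that] using lam by (simp add: Re_divide power2_eq_square)
  have ann: "1 - \<delta> \<le> norm (\<gamma> y)" "norm (\<gamma> y) \<le> 1 + \<delta>" if "y \<in> {u..v}" for y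
    using \<gamma>(2)[of y] that uv by (auto simp: annulus_def)
  have small: "norm (f y) < 1 - \<delta>" if "y \<in> {u..v}" "\<theta> y = \<alpha>" for y
  proof -
    have "f y = of_real (norm (\<gamma> y) - 1) / (\<i> * of_real \<mu>)"
      unfolding f[OF that(1)] using that(2) by simp
    then have "norm (f y) = \<bar>norm (\<gamma> y) - 1\<bar> / \<mu>"
      using lam by (simp only: norm_divide norm_mult norm_of_real norm_ii)
    also have "\<dots> \<le> \<delta> / \<mu>" using ann[OF that(1)] lam by (intro divide_right_mono) auto
    finally show ?thesis using lam delta delta_bounds by simp
  qed
  have large: "1 + \<delta> \<le> norm (f y)" if "y \<in> {u..v}" "\<theta> y = \<alpha> + pi / 2" for y
  proof -
    have "(1 + \<delta>) * \<mu> \<le> norm (\<gamma> y)"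
      using ann(1)[OF that(1)] lam delta_bounds mult_mono[of "1 + \<delta>" 2 \<mu> "1 / 20"] by simp
    moreover have "sin (\<theta> y - \<alpha>) = 1" unfolding that(2) by simp
    ultimately have "1 + \<delta> \<le> Re (f y)"
      unfolding Re_f[OF that(1)] using lam by (simp add: pos_le_divide_eq)
    then show ?thesis using complex_Re_le_cmod[of "f y"] by linarith
  qed
  have cf: "continuous_on {u..v} f"
    unfolding f_def
    by (rule continuous_on_compose2[of UNIV "unplace b" "{u..v}" \<gamma>])
      (use \<gamma>(1) uv(1,3) smooth_perm_continuous[OF smooth_perm_place(2)[OF assms(2)]]
        in \<open>auto intro: continuous_on_subset\<close>)
  have ends: "(norm (f u) \<le> 1 - \<delta> \<and> 1 + \<delta> \<le> norm (f v)) \<or> (1 + \<delta> \<le> norm (f u) \<and> norm (f v) \<le> 1 - \<delta>)"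
    using uv(2,5) small[of u] small[of v] large[of u] large[of v] by auto
  have cn: "continuous_on {u..v} (\<lambda>y. norm (f y))" using cf by (intro continuous_intros)
  obtain s' t' where st: "u \<le> s'" "s' < t'" "t' \<le> v"
    "(norm (f s') = 1 - \<delta> \<and> norm (f t') = 1 + \<delta>) \<or> (norm (f s') = 1 + \<delta> \<and> norm (f t') = 1 - \<delta>)"
    "\<And>x. x \<in> {s'..t'} \<Longrightarrow> 1 - \<delta> \<le> norm (f x) \<and> norm (f x) \<le> 1 + \<delta>"
    using crossing_subinterval[OF cn _ _ ends] uv(2) delta_bounds by auto
  have Re_pos: "Re (f x * 1) > 0" if "x \<in> {s'..t'}" for x
  proof -
    have x: "x \<in> {u..v}" using that st by auto
    have "\<theta> x \<noteq> \<alpha>" using small[OF x] st(5)[OF that] by auto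
    then have "sin (\<theta> x - \<alpha>) > 0" using uv(4)[OF x] pi_gt_zero by (intro sin_gt_zero) linarith+
    moreover have "norm (\<gamma> x) > 0" using ann(1)[OF x] delta_bounds by linarith
    ultimately show ?thesis using Re_f[OF x] lam by simp
  qed
  show ?thesis
  proof (rule that[of s' t'])
    have "continuous_on {s'..t'} f" using cf st by (auto intro: continuous_on_subset)
    moreover have "f ` {s'..t'} \<subseteq> annulus \<delta>" using st(5) by (auto simp: annulus_def)
    ultimately have "crosses \<delta> f s' t'"
      unfolding crosses_def using st(2,4) Re_pos by (metis zero_neq_one)
    then show "crosses \<delta> (unplace b \<circ> \<gamma>) s' t'" by (simp add: f_def[abs_def] o_def)
    show "Im (unplace b (\<gamma> x)) \<le> 1 / 2" if "x \<in> {s'..t'}" for x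
    proof (rule annulus_in_disc[OF assms(2)])
      show "norm (unplace b (\<gamma> x)) < 2" using st(5)[OF that] delta_bounds by (auto simp: f_def)
      show "place b (unplace b (\<gamma> x)) \<in> annulus \<delta>"
        using that st uv \<gamma>(2)[of x] by (simp add: place_unplace assms)
    qed
  qed (use st uv in auto)
qed

text \<open>In the coordinates of the child, the points of its annulus on the negative imaginary axis lie outside
  the outer circle of the root annulus, and those on the positive imaginary axis lie inside the
  inner circle. So a path that passes through the right half of the child annulus crosses the root
  annulus.\<close>

lemma exit_child:
  assumes "sweeps \<delta> \<gamma> s t" "b \<in> V"
  obtains s' t' where "s \<le> s'" "s' < t'" "t' \<le> t" "crosses \<delta> (place b \<circ> \<gamma>) s' t'"
    "\<And>x. x \<in> {s'..t'} \<Longrightarrow> norm (\<gamma> x) < 2 \<and> Im (\<gamma> x) \<le> 1 / 2"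
proof -
  have \<gamma>: "continuous_on {s..t} \<gamma>" "\<And>x. x \<in> {s..t} \<Longrightarrow> \<gamma> x \<in> annulus \<delta>"
    using assms by (auto simp: sweeps_def)
  obtain u v \<theta> where uv: "s \<le> u" "u < v" "v \<le> t"
    "\<And>y. y \<in> {u..v} \<Longrightarrow> \<gamma> y = norm (\<gamma> y) * cis (\<theta> y) \<and> - (pi / 2) \<le> \<theta> y \<and> \<theta> y \<le> - (pi / 2) + pi"
    "(\<theta> u = - (pi / 2) \<and> \<theta> v = - (pi / 2) + pi) \<or> (\<theta> u = - (pi / 2) + pi \<and> \<theta> v = - (pi / 2))"
    using sweeps_subarc[OF assms(1), of pi "- (pi / 2)"] by auto
  define f where "f y = place b (\<gamma> y)" for y
  have ann: "1 - \<delta> \<le> norm (\<gamma> y)" "norm (\<gamma> y) \<le> 1 + \<delta>" if "y \<in> {u..v}" for y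
    using \<gamma>(2)[of y] that uv by (auto simp: annulus_def)
  have small: "norm (f y) \<le> 1 - \<delta>" if "y \<in> {u..v}" "\<theta> y = - (pi / 2) + pi" for y
  proof -
    have "\<gamma> y = norm (\<gamma> y) * \<i>" using uv(4)[OF that(1)] that(2) by simp
    then have "f y = q b * (1 + \<i> * of_real \<mu> * (norm (\<gamma> y) * \<i>))"
      unfolding f_def place_def by metis
    then have "f y = q b * of_real (1 - \<mu> * norm (\<gamma> y))" by (simp add: algebra_simps)
    then have "norm (f y) = \<bar>1 - \<mu> * norm (\<gamma> y)\<bar>"
      using norm_q[OF assms(2)] by (simp only: norm_mult norm_of_real) simp
    moreover have "\<mu> * norm (\<gamma> y) \<le> 1"
      using ann(2)[OF that(1)] lam delta_bounds mult_mono[of \<mu> "1 / 20" "norm (\<gamma> y)" 2] by simp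
    moreover have "\<mu> * (1 / 2) \<le> \<mu> * norm (\<gamma> y)"
      using ann(1)[OF that(1)] lam delta_bounds by (intro mult_left_mono) auto
    moreover have "\<delta> \<le> \<mu> * (1 / 2)" using delta lam by simp
    ultimately show ?thesis by linarith
  qed
  have large: "1 + \<delta> \<le> norm (f y)" if "y \<in> {u..v}" "\<theta> y = - (pi / 2)" for y
  proof -
    have "\<gamma> y = norm (\<gamma> y) * (- \<i>)" using uv(4)[OF that(1)] that(2) by simp
    then have "f y = q b * (1 + \<i> * of_real \<mu> * (norm (\<gamma> y) * (- \<i>)))"
      unfolding f_def place_def by metis
    then have "f y = q b * of_real (1 + \<mu> * norm (\<gamma> y))" by (simp add: algebra_simps)
    then have "norm (f y) = \<bar>1 + \<mu> * norm (\<gamma> y)\<bar>"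
      using norm_q[OF assms(2)] by (simp only: norm_mult norm_of_real) simp
    moreover have "\<mu> * (1 / 2) \<le> \<mu> * norm (\<gamma> y)"
      using ann(1)[OF that(1)] lam delta_bounds by (intro mult_left_mono) auto
    moreover have "\<delta> \<le> \<mu> * (1 / 2)" using delta lam by simp
    ultimately show ?thesis by linarith
  qed
  have cf: "continuous_on {u..v} f"
    unfolding f_def
    by (rule continuous_on_compose2[of UNIV "place b" "{u..v}" \<gamma>])
      (use \<gamma>(1) uv(1,3) smooth_perm_continuous[OF smooth_perm_place(1)[OF assms(2)]]
        in \<open>auto intro: continuous_on_subset\<close>)
  have ends: "(norm (f u) \<le> 1 - \<delta> \<and> 1 + \<delta> \<le> norm (f v)) \<or> (1 + \<delta> \<le> norm (f u) \<and> norm (f v) \<le> 1 - \<delta>)"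
    using uv(2,5) small[of u] small[of v] large[of u] large[of v] by auto
  have cn: "continuous_on {u..v} (\<lambda>y. norm (f y))" using cf by (intro continuous_intros)
  obtain s' t' where st: "u \<le> s'" "s' < t'" "t' \<le> v"
    "(norm (f s') = 1 - \<delta> \<and> norm (f t') = 1 + \<delta>) \<or> (norm (f s') = 1 + \<delta> \<and> norm (f t') = 1 - \<delta>)"
    "\<And>x. x \<in> {s'..t'} \<Longrightarrow> 1 - \<delta> \<le> norm (f x) \<and> norm (f x) \<le> 1 + \<delta>"
    using crossing_subinterval[OF cn _ _ ends] uv(2) delta_bounds by auto
  have g2: "norm (\<gamma> x) < 2" if "x \<in> {s'..t'}" for x
    using ann(2)[of x] that st delta_bounds by auto
  have Im: "Im (\<gamma> x) \<le> 1 / 2" if "x \<in> {s'..t'}" for x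
    using annulus_in_disc[OF assms(2) g2[OF that]] st(5)[OF that] by (auto simp: f_def annulus_def)
  have Re_pos: "Re (f x * cnj (q b)) > 0" if "x \<in> {s'..t'}" for x
  proof -
    have "f x * cnj (q b) = 1 + \<i> * of_real \<mu> * \<gamma> x"
      using q_cnj[OF assms(2)] by (simp add: f_def place_def)
    then have "Re (f x * cnj (q b)) = 1 - \<mu> * Im (\<gamma> x)" by simp
    moreover have "\<mu> * Im (\<gamma> x) \<le> \<mu> * (1 / 2)" using Im[OF that] lam by (intro mult_left_mono) auto
    moreover have "\<mu> * (1 / 2) < 1" using lam by simp
    ultimately show ?thesis by linarith
  qed
  show ?thesis
  proof (rule that[of s' t'])
    have "continuous_on {s'..t'} f" using cf st by (auto intro: continuous_on_subset)
    moreover have "f ` {s'..t'} \<subseteq> annulus \<delta>" using st(5) by (auto simp: annulus_def)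
    moreover have "cnj (q b) \<noteq> 0" using norm_q[OF assms(2)] by auto
    ultimately have "crosses \<delta> f s' t'"
      unfolding crosses_def using st(2,4) Re_pos by metis
    then show "crosses \<delta> (place b \<circ> \<gamma>) s' t'" by (simp add: f_def[abs_def] o_def)
    show "norm (\<gamma> x) < 2 \<and> Im (\<gamma> x) \<le> 1 / 2" if "x \<in> {s'..t'}" for x
      using g2 Im that by auto
  qed (use st uv in auto)
qed

text \<open>Where the child labelled \<open>b\<close> meets its parent, the letters other than \<open>b\<close> act trivially.\<close>

lemma word_map_child_map_fixes:
  assumes "g \<in> words (S - {b})" "Im z \<le> 1 / 2"
  shows "word_map (child_map k b) g z = z"
  using assms child_map_Im
  by (intro word_map_fixes[of "S - {b}"]) (auto simp: smooth_perm_bij smooth_perm_child_map)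

text \<open>The induction hypothesis of the ping-pong argument. Think of \<open>N\<close> as the letters that do not commute
  with the letter of the root annulus: a word over \<open>S\<close> is then useful as soon as it does not lie in
  the subgroup generated by the other letters of \<open>S\<close>.\<close>

definition moves_across :: "nat \<Rightarrow> 'v set \<Rightarrow> bool" where
  "moves_across k S \<longleftrightarrow> (\<forall>N g \<gamma> s t. N \<subseteq> V \<longrightarrow> g \<in> words S \<longrightarrow> \<not> (\<exists>g'\<in>words (S - N). g \<doteq> g') \<longrightarrow>
     sweeps \<delta> \<gamma> s t \<longrightarrow>
     (\<exists>s' t'. s \<le> s' \<and> s' < t' \<and> t' \<le> t \<and> crosses \<delta> (word_map (tree_map k N) g \<circ> \<gamma>) s' t'))"

text \<open>Each block of \<open>b\<close> turns a path crossing the annulus of \<open>b\<close> into a sweeping one, and each word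
  between two blocks restores a crossing path by the induction hypothesis, since the children of
  this annulus are labelled by the letters outside the link of \<open>b\<close>. The first factor to act is the
  last one, and it acts trivially, since the path starts where only \<open>b\<close> moves points.\<close>

lemma alternating_sweeps:
  assumes "moves_across k (S - {b})" "b \<in> S" "S \<subseteq> V"
    "alternating S b h" "crosses \<delta> \<gamma> s t" "\<And>x. x \<in> {s..t} \<Longrightarrow> Im (\<gamma> x) \<le> 1 / 2"
  shows "\<exists>s' t'. s \<le> s' \<and> s' < t' \<and> t' \<le> t \<and> sweeps \<delta> (word_map (child_map k b) h \<circ> \<gamma>) s' t'"
  using assms(4)
proof (induction rule: alternating.induct)
  case (single B g)
  have "crosses \<delta> (word_map (child_map k b) g \<circ> \<gamma>) s t"
    using word_map_child_map_fixes[OF single(3)] assms(6)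
    by (intro crosses_cong[OF _ assms(5)]) simp
  then have "sweeps \<delta> (word_map (child_map k b) B \<circ> (word_map (child_map k b) g \<circ> \<gamma>)) s t"
    by (rule crosses_imp_twist_sweeps) (use delta_bounds single in \<open>auto simp: child_map_def\<close>)
  moreover have "s < t" using assms(5) by (simp add: crosses_def)
  ultimately show ?case by (auto simp only: word_map_append o_assoc)
next
  case (step B g h)
  let ?W = "word_map (child_map k b)"
  obtain s1 t1 where 1: "s \<le> s1" "s1 < t1" "t1 \<le> t" "sweeps \<delta> (?W h \<circ> \<gamma>) s1 t1"
    using step.IH by blast
  have "(S - {b}) - nonadj b = {u \<in> S. {u, b} \<in> E}"
    using assms(3) edge_neq by (auto simp: nonadj_def)
  then have "\<not> (\<exists>g'\<in>words ((S - {b}) - nonadj b). g \<doteq> g')" using step by simp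
  moreover have "nonadj b \<subseteq> V" by (auto simp: nonadj_def)
  ultimately obtain s2 t2 where 2: "s1 \<le> s2" "s2 < t2" "t2 \<le> t1"
    "crosses \<delta> (word_map (tree_map k (nonadj b)) g \<circ> (?W h \<circ> \<gamma>)) s2 t2"
    using assms(1) step(3) 1(4) unfolding moves_across_def by meson
  have "word_map (tree_map k (nonadj b)) g = ?W g"
    by (rule word_map_cong[OF _ step(3)]) (auto simp: child_map_def)
  then have "sweeps \<delta> (?W B \<circ> (?W g \<circ> (?W h \<circ> \<gamma>))) s2 t2"
    using 2(4) delta_bounds step by (intro crosses_imp_twist_sweeps) (auto simp: child_map_def)
  then have "sweeps \<delta> (?W (B @ g @ h) \<circ> \<gamma>) s2 t2"
    by (simp only: word_map_append o_assoc)
  moreover have "s \<le> s2" "t2 \<le> t" using 1 2 by linarith+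
  ultimately show ?case using 2(2) by blast
qed

text \<open>Some letter \<open>b\<close> of \<open>S\<close> lies in \<open>N\<close>. Either the word can be rewritten without \<open>b\<close>, and the alphabet
  shrinks, or it is equal to \<open>g\<^sub>0 h\<close> with \<open>h\<close> alternating. Then the path enters the child labelled \<open>b\<close>, is
  made to sweep around it by \<open>h\<close>, hence crosses the root annulus again, at a place where \<open>g\<^sub>0\<close> acts
  trivially. Below the child only the alphabet without \<open>b\<close> matters, which is why one level of the tree
  per letter is enough.\<close>

lemma moves_across_Suc:
  assumes "\<And>S. S \<subseteq> V \<Longrightarrow> card S \<le> k \<Longrightarrow> moves_across k S" "S \<subseteq> V" "card S \<le> Suc k"
  shows "moves_across (Suc k) S"
proof -
  have "finite S" using assms(2) vs finite_subset by blast
  then show ?thesis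
    using assms(2,3)
  proof (induction S rule: finite_psubset_induct)
    case (psubset S)
    show ?case
      unfolding moves_across_def
    proof (intro allI impI)
      fix N g \<gamma> s t
      assume N: "N \<subseteq> V" and g: "g \<in> words S" "\<not> (\<exists>g'\<in>words (S - N). g \<doteq> g')"
        and \<gamma>: "sweeps \<delta> \<gamma> s t"
      let ?T = "word_map (tree_map (Suc k) N)"
      have "\<exists>b. b \<in> S \<inter> N"
      proof (rule ccontr)
        assume "\<not> ?thesis"
        then have "S - N = S" by auto
        then have "\<not> (\<exists>g'\<in>words S. g \<doteq> g')" using g(2) by simp
        moreover have "words S \<subseteq> words V" using psubset.prems(1) by (intro lists_mono) auto
        then have "g \<doteq> g" using g(1) by (intro word_eq.refl) blast
        ultimately show False using g(1) by blast
      qed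
      then obtain b where b: "b \<in> S" "b \<in> N" by auto
      then have bV: "b \<in> V" using N by auto
      have less: "S - {b} \<subset> S" "S - {b} \<subseteq> V" "card (S - {b}) \<le> k" "card (S - {b}) \<le> Suc k"
        using b psubset by (auto simp: card_Diff_singleton)
      consider g' where "g' \<in> words (S - {b})" "g \<doteq> g'" |
        g0 h where "g0 \<in> words (S - {b})" "alternating S b h" "g \<doteq> g0 @ h"
        using alternating_decomposition[OF g(1) psubset.prems(1) b(1)] by blast
      then show "\<exists>s' t'. s \<le> s' \<and> s' < t' \<and> t' \<le> t \<and> crosses \<delta> (?T g \<circ> \<gamma>) s' t'"
      proof cases
        case (1 g')
        have "\<not> (\<exists>g''\<in>words (S - {b} - N). g' \<doteq> g'')"
        proof
          assume "\<exists>g''\<in>words (S - {b} - N). g' \<doteq> g''"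
          then obtain g'' where g'': "g'' \<in> words (S - {b} - N)" "g' \<doteq> g''" by blast
          have "words (S - {b} - N) \<subseteq> words (S - N)" by (intro lists_mono) auto
          moreover have "g \<doteq> g''" using 1(2) g''(2) by (rule word_eq.trans)
          ultimately show False using g(2) g''(1) by blast
        qed
        then show ?thesis
          using psubset.IH[OF less(1,2,4)] N 1(1) \<gamma>
          unfolding moves_across_def word_map_tree_map_eq[OF 1(2)] by blast
      next
        case (2 g0 h)
        let ?W = "word_map (child_map k b)"
        obtain s1 t1 where 1: "s \<le> s1" "s1 < t1" "t1 \<le> t" "crosses \<delta> (unplace b \<circ> \<gamma>) s1 t1"
          "\<And>x. x \<in> {s1..t1} \<Longrightarrow> Im (unplace b (\<gamma> x)) \<le> 1 / 2"
          using enter_child[OF \<gamma> bV] by blast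
        obtain s2 t2 where 4: "s1 \<le> s2" "s2 < t2" "t2 \<le> t1" "sweeps \<delta> (?W h \<circ> (unplace b \<circ> \<gamma>)) s2 t2"
          using alternating_sweeps[OF assms(1)[OF less(2,3)] b(1) psubset.prems(1) 2(2) 1(4)] 1(5) by auto
        obtain s3 t3 where 3: "s2 \<le> s3" "s3 < t3" "t3 \<le> t2"
          "crosses \<delta> (place b \<circ> (?W h \<circ> (unplace b \<circ> \<gamma>))) s3 t3"
          "\<And>x. x \<in> {s3..t3} \<Longrightarrow> norm (?W h (unplace b (\<gamma> x))) < 2 \<and> Im (?W h (unplace b (\<gamma> x))) \<le> 1 / 2"
          using exit_child[OF 4(4) bV] by auto
        have "crosses \<delta> (?T g \<circ> \<gamma>) s3 t3"
        proof (rule crosses_cong[OF _ 3(4)])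
          fix x assume x: "x \<in> {s3..t3}"
          then have "unplace b (\<gamma> x) \<in> annulus \<delta>"
            using 1 4 3 by (auto simp: crosses_def)
          then have n: "norm (unplace b (\<gamma> x)) < 2" by (rule annulus_norm)
          have "?T g (\<gamma> x) = ?T (g0 @ h) (place b (unplace b (\<gamma> x)))"
            using word_map_tree_map_eq[OF 2(3)] bV by (simp add: place_unplace)
          also have "\<dots> = place b (?W g0 (?W h (unplace b (\<gamma> x))))"
            unfolding word_map_place[OF b(2) bV n] by (simp add: word_map_append)
          also have "?W g0 (?W h (unplace b (\<gamma> x))) = ?W h (unplace b (\<gamma> x))"
            using word_map_child_map_fixes[OF 2(1)] 3(5)[OF x] by blast
          finally show "(place b \<circ> (?W h \<circ> (unplace b \<circ> \<gamma>))) x = (?T g \<circ> \<gamma>) x" by simp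
        qed
        then show ?thesis using 1 4 3 by (intro exI[of _ s3] exI[of _ t3]) auto
      qed
    qed
  qed
qed

lemma moves_across: "S \<subseteq> V \<Longrightarrow> card S \<le> k \<Longrightarrow> moves_across k S"
proof (induction k arbitrary: S)
  case 0
  then have "S = {}" using vs finite_subset[of S V] by auto
  then show ?case
    unfolding moves_across_def by (auto intro: word_eq.refl)
next
  case (Suc k)
  then show ?case using moves_across_Suc by blast
qed

text \<open>At the top every letter labels a child, so a word is useful unless it is trivial. The unit circle
  is swept by a path that stays away from the boundary circles of the root annulus, and hence a word
  fixing all its points does not produce a crossing.\<close>

theorem tree_map_faithful:
  assumes "w \<in> words V" "word_map (tree_map (card V) V) w = id"
  shows "w \<doteq> []"
proof (rule ccontr)
  assume w: "\<not> w \<doteq> []"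
  have "sweeps \<delta> cis 0 (3 * pi)"
    unfolding sweeps_def
    by (auto intro!: exI[of _ "\<lambda>x. x"] continuous_intros simp: annulus_def delta_bounds less_imp_le)
  moreover have "\<not> (\<exists>g'\<in>words (V - V). w \<doteq> g')" using w by auto
  ultimately obtain s' t' where "crosses \<delta> (word_map (tree_map (card V) V) w \<circ> cis) s' t'"
    using moves_across[of V "card V"] assms(1) unfolding moves_across_def by blast
  then show False using delta_bounds by (auto simp: assms(2) crosses_def)
qed

end

section \<open>Orientation\<close>

definition jacobian_det :: "(real ^ 'n::finite \<Rightarrow> real ^ 'n) \<Rightarrow> real ^ 'n \<Rightarrow> real" where
  "jacobian_det f x = det (matrix (frechet_derivative f (at x)))"

lemma jacobian_det_cong:
  assumes "open S" "x \<in> S" "\<And>y. y \<in> S \<Longrightarrow> f y = g y"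
  shows "jacobian_det f x = jacobian_det g x"
  unfolding jacobian_det_def using frechet_derivative_cong_open[OF assms] by simp

lemma jacobian_det_compose:
  fixes f g :: "real ^ 'n::finite \<Rightarrow> real ^ 'n"
  assumes "(f has_derivative f') (at x)" "(g has_derivative g') (at (f x))"
  shows "jacobian_det (\<lambda>x. g (f x)) x = jacobian_det g (f x) * jacobian_det f x"
proof -
  have lin: "linear f'" "linear g'" using assms has_derivative_linear by auto
  have "((\<lambda>x. g (f x)) has_derivative g' \<circ> f') (at x)"
    using diff_chain_at[OF assms] by (simp add: o_def)
  then have "frechet_derivative (\<lambda>x. g (f x)) (at x) = g' \<circ> f'"
    "frechet_derivative f (at x) = f'" "frechet_derivative g (at (f x)) = g'"
    using assms frechet_derivative_at by metis+
  then show ?thesis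
    unfolding jacobian_det_def by (simp only: matrix_compose[OF lin] det_mul)
qed

lemma jacobian_det_ident: "jacobian_det (\<lambda>x. x) y = 1"
proof -
  have "frechet_derivative (\<lambda>x. x) (at y) = (\<lambda>x. x)" by (rule frechet_derivative_ident)
  then show ?thesis by (simp add: jacobian_det_def matrix_id_mat_1[unfolded id_def])
qed

text \<open>The determinant is a continuous function without zeros on a connected space, and it equals 1 outside
  the support. So compactly supported diffeomorphisms preserve the orientation for free.\<close>

lemma jacobian_det_pos_of_compact_support:
  fixes F :: "real ^ 'n::finite \<Rightarrow> real ^ 'n"
  assumes F: "smooth_perm F" and K: "compact K" "\<And>y. y \<notin> K \<Longrightarrow> F y = y"
  shows "jacobian_det F x > 0"
proof -
  have der: "(F has_derivative frechet_derivative F (at y)) (at y)"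
    "(inv_into UNIV F has_derivative frechet_derivative (inv_into UNIV F) (at y)) (at y)" for y
    using F by (auto simp: smooth_perm_def intro: Cinf_on_has_derivative)
  have nz: "jacobian_det F y \<noteq> 0" for y
  proof -
    have "jacobian_det (\<lambda>x. inv_into UNIV F (F x)) y = jacobian_det (inv_into UNIV F) (F y) * jacobian_det F y"
      by (rule jacobian_det_compose[OF der(1) der(2)])
    moreover have "(\<lambda>x. inv_into UNIV F (F x)) = (\<lambda>x. x)"
      using F by (auto simp: smooth_perm_def bij_is_inj)
    ultimately show ?thesis using jacobian_det_ident[of y] by auto
  qed
  have "continuous_on UNIV (\<lambda>y. frechet_derivative F (at y) v)" for v
    using F by (intro Cinf_on_imp_continuous_on Cinf_on_frechet_derivative) (simp add: smooth_perm_def)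
  then have cont: "continuous_on UNIV (jacobian_det F)"
    unfolding jacobian_det_def[abs_def] det_def matrix_def
    by (auto intro!: continuous_intros)
  have "\<not> (UNIV :: (real ^ 'n) set) \<subseteq> K"
    using K(1) not_bounded_UNIV compact_imp_bounded by (metis top.extremum_uniqueI)
  then obtain y0 where y0: "y0 \<notin> K" by auto
  have "jacobian_det F y0 = jacobian_det (\<lambda>x. x) y0"
    by (rule jacobian_det_cong[of "- K"]) (use y0 K in \<open>auto intro: compact_imp_closed\<close>)
  then have one: "jacobian_det F y0 = 1" by (simp add: jacobian_det_ident)
  have "connected (jacobian_det F ` UNIV)" by (rule connected_continuous_image[OF cont connected_UNIV])
  then have "is_interval (jacobian_det F ` UNIV)" by (simp add: is_interval_connected_1)
  show ?thesis
  proof (rule ccontr)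
    assume "\<not> ?thesis"
    then have "0 \<in> jacobian_det F ` UNIV"
      using \<open>is_interval (jacobian_det F ` UNIV)\<close> one unfolding is_interval_1
      by (metis UNIV_I image_eqI not_less zero_le_one)
    then show False using nz by (metis imageE)
  qed
qed

section \<open>Transplanting a compactly supported diffeomorphism into a chart\<close>

lemma chart_onD:
  assumes "chart_on X (U, \<phi>)"
  shows "openin X U" "open (\<phi> ` U)" "inj_on \<phi> U"
    "continuous_map (subtopology X U) euclidean \<phi>"
    "continuous_map (top_of_set (\<phi> ` U)) X (inv_into U \<phi>)"
    "\<And>W. openin X W \<Longrightarrow> W \<subseteq> U \<Longrightarrow> open (\<phi> ` W)"
proof -
  show U: "openin X U" "open (\<phi> ` U)" using assms by (auto simp: chart_on_def)
  have h: "homeomorphic_map (subtopology X U) (top_of_set (\<phi> ` U)) \<phi>"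
    using assms by (simp add: chart_on_def)
  have t: "topspace (subtopology X U) = U" using openin_subset[OF U(1)] by auto
  show inj: "inj_on \<phi> U" using homeomorphic_imp_injective_map[OF h] t by simp
  obtain g where g: "homeomorphic_maps (subtopology X U) (top_of_set (\<phi> ` U)) \<phi> g"
    using h homeomorphic_map_maps by blast
  then show "continuous_map (subtopology X U) euclidean \<phi>"
    by (simp add: homeomorphic_maps_def continuous_map_in_subtopology)
  have "continuous_map (top_of_set (\<phi> ` U)) X g"
    using g by (simp add: homeomorphic_maps_def continuous_map_in_subtopology)
  moreover have "g y = inv_into U \<phi> y" if "y \<in> \<phi> ` U" for y
    using that g t inj by (auto simp: homeomorphic_maps_def)
  ultimately show "continuous_map (top_of_set (\<phi> ` U)) X (inv_into U \<phi>)"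
    by (elim continuous_map_eq) auto
  show "open (\<phi> ` W)" if "openin X W" "W \<subseteq> U" for W
  proof -
    have "openin (subtopology X U) W" using that U(1) by (simp add: openin_open_subtopology)
    then have "openin (top_of_set (\<phi> ` U)) (\<phi> ` W)"
      using homeomorphic_imp_open_map[OF h] by (simp add: open_map_def)
    then show ?thesis using U(2) openin_open_trans by blast
  qed
qed

locale chart_support =
  fixes X :: "'a topology" and U :: "'a set" and \<phi> :: "'a \<Rightarrow> real ^ 'n::finite" and K :: "(real ^ 'n) set"
  assumes chart: "chart_on X (U, \<phi>)" and Hausdorff: "Hausdorff_space X"
    and K: "compact K" "K \<subseteq> \<phi> ` U"
begin

abbreviation chart_inv :: "real ^ 'n \<Rightarrow> 'a" where
  "chart_inv \<equiv> inv_into U \<phi>"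

definition transplant :: "(real ^ 'n \<Rightarrow> real ^ 'n) \<Rightarrow> 'a \<Rightarrow> 'a" where
  "transplant F = (\<lambda>x\<in>topspace X. if x \<in> U then chart_inv (F (\<phi> x)) else x)"

definition supported :: "(real ^ 'n \<Rightarrow> real ^ 'n) \<Rightarrow> bool" where
  "supported F \<longleftrightarrow> smooth_perm F \<and> (\<forall>y. y \<notin> K \<longrightarrow> F y = y)"

lemma U_subset: "U \<subseteq> topspace X"
  using chart_onD(1)[OF chart] openin_subset by blast

lemma chart_inv_inverse: "x \<in> U \<Longrightarrow> chart_inv (\<phi> x) = x"
  using chart_onD(3)[OF chart] by simp

lemma supported_image_chart:
  assumes "supported F" "y \<in> \<phi> ` U"
  shows "F y \<in> \<phi> ` U"
proof (cases "F y = y")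
  case False
  (* a point which is moved has its image moved too *)
  then have "F (F y) \<noteq> F y"
    using assms by (metis bij_is_inj injD smooth_perm_bij supported_def)
  then have "F y \<in> K" using assms(1) unfolding supported_def by blast
  then show ?thesis using K by blast
qed (use assms in simp)

lemma transplant_chart:
  assumes "supported F" "x \<in> U"
  shows "transplant F x \<in> U" "\<phi> (transplant F x) = F (\<phi> x)"
proof -
  have "F (\<phi> x) \<in> \<phi> ` U" using supported_image_chart assms by blast
  then show "transplant F x \<in> U" "\<phi> (transplant F x) = F (\<phi> x)"
    using assms U_subset by (auto simp: transplant_def inv_into_into f_inv_into_f)
qed

lemma transplant_outside:
  assumes "supported F" "x \<in> topspace X" "x \<notin> chart_inv ` K"
  shows "transplant F x = x"
proof (cases "x \<in> U")
  case True
  then have "\<phi> x \<notin> K" using assms(3) chart_inv_inverse by (metis imageI)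
  then show ?thesis
    using True assms by (simp add: transplant_def supported_def chart_inv_inverse)
qed (use assms in \<open>simp add: transplant_def\<close>)

lemma transplant_topspace: "supported F \<Longrightarrow> x \<in> topspace X \<Longrightarrow> transplant F x \<in> topspace X"
  using transplant_chart[of F x] U_subset by (cases "x \<in> U") (auto simp: transplant_def)

lemma transplant_comp:
  assumes "supported F" "supported G"
  shows "transplant (F \<circ> G) = compose (topspace X) (transplant F) (transplant G)"
proof
  fix x
  show "transplant (F \<circ> G) x = compose (topspace X) (transplant F) (transplant G) x"
  proof (cases "x \<in> U")
    case True
    then have "transplant F (transplant G x) = chart_inv (F (G (\<phi> x)))"
      using transplant_chart[OF assms(2) True] U_subset by (auto simp: transplant_def)
    then show ?thesis using True U_subset by (auto simp: transplant_def compose_def)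
  qed (auto simp: transplant_def compose_def)
qed

lemma transplant_id: "transplant id = (\<lambda>x\<in>topspace X. x)"
  by (auto simp: transplant_def fun_eq_iff chart_inv_inverse)

lemma supported_inv: 
  assumes "supported F" shows "supported (inv_into UNIV F)"
proof -
  have "inv_into UNIV F y = y" if "y \<notin> K" for y
    using that assms by (metis inv_f_f bij_is_inj smooth_perm_bij supported_def)
  then show ?thesis using assms smooth_perm_inv by (auto simp: supported_def)
qed

lemma transplant_inverse:
  assumes "supported F" "x \<in> topspace X"
  shows "transplant F (transplant (inv_into UNIV F) x) = x"
    "transplant (inv_into UNIV F) (transplant F x) = x"
proof -
  have b: "bij F" using assms by (simp add: supported_def smooth_perm_bij)
  have "F \<circ> inv_into UNIV F = id" "inv_into UNIV F \<circ> F = id"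
    using b by (auto simp: fun_eq_iff bij_is_inj bij_is_surj surj_f_inv_f)
  then have "compose (topspace X) (transplant F) (transplant (inv_into UNIV F)) = (\<lambda>x\<in>topspace X. x)"
    "compose (topspace X) (transplant (inv_into UNIV F)) (transplant F) = (\<lambda>x\<in>topspace X. x)"
    using transplant_comp[OF assms(1) supported_inv[OF assms(1)]]
      transplant_comp[OF supported_inv[OF assms(1)] assms(1)] transplant_id by auto
  then show "transplant F (transplant (inv_into UNIV F) x) = x"
    "transplant (inv_into UNIV F) (transplant F x) = x"
    using assms(2) by (metis compose_eq restrict_apply')+
qed

lemma transplant_Bij:
  assumes "supported F"
  shows "transplant F \<in> Bij (topspace X)"
proof -
  have "bij_betw (transplant F) (topspace X) (topspace X)"
    by (rule bij_betw_byWitness[where f' = "transplant (inv_into UNIV F)"])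
      (use transplant_inverse[OF assms] transplant_topspace[OF assms]
        transplant_topspace[OF supported_inv[OF assms]] in auto)
  then show ?thesis by (simp add: Bij_def transplant_def)
qed

lemma inv_into_transplant:
  assumes "supported F" "x \<in> topspace X"
  shows "inv_into (topspace X) (transplant F) x = transplant (inv_into UNIV F) x"
proof (rule inv_into_f_eq)
  show "inj_on (transplant F) (topspace X)"
    using transplant_Bij[OF assms(1)] by (simp add: Bij_def bij_betw_def)
qed (use assms transplant_inverse transplant_topspace supported_inv in auto)

lemma closedin_support: "closedin X (chart_inv ` K)"
proof (rule compactin_imp_closedin[OF Hausdorff])
  have "compactin (top_of_set (\<phi> ` U)) K"
    using K by (simp add: compactin_subtopology)
  then show "compactin X (chart_inv ` K)"
    using chart_onD(5)[OF chart] by (rule image_compactin)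
qed

lemma continuous_map_transplant:
  assumes "supported F" "\<And>x. x \<in> topspace X \<Longrightarrow> g x = transplant F x"
  shows "continuous_map X X g"
proof -
  let ?T = "\<lambda>b. if b then U else topspace X - chart_inv ` K"
  let ?f = "\<lambda>b. if b then chart_inv \<circ> (F \<circ> \<phi>) else (\<lambda>x. x)"
  have gU: "g x = chart_inv (F (\<phi> x))" if "x \<in> U" for x
    using that assms(2) U_subset by (auto simp: transplant_def)
  have gK: "g x = x" if "x \<in> topspace X - chart_inv ` K" for x
    using that assms transplant_outside by auto
  show ?thesis
  proof (rule pasting_lemma[where I = UNIV and T = ?T and f = ?f])
    show "openin X (?T b)" for b
      using chart_onD(1)[OF chart] closedin_support by (auto simp: openin_diff)
    show "continuous_map (subtopology X (?T b)) X (?f b)" for b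
    proof (cases b)
      case True
      have "continuous_map euclidean euclidean F"
        using assms(1) smooth_perm_continuous by (auto simp: supported_def)
      then have "continuous_map (subtopology X U) euclidean (F \<circ> \<phi>)"
        using chart_onD(4)[OF chart] continuous_map_compose by blast
      then have "continuous_map (subtopology X U) (top_of_set (\<phi> ` U)) (F \<circ> \<phi>)"
        using supported_image_chart[OF assms(1)] by (auto simp: continuous_map_in_subtopology)
      then show ?thesis
        using continuous_map_compose[OF _ chart_onD(5)[OF chart]] True by auto
    next
      case False
      then show ?thesis by (simp add: continuous_map_from_subtopology)
    qed
    show "?f i x = ?f j x" if "x \<in> topspace X \<inter> ?T i \<inter> ?T j" for i j x
    proof (cases "i = j")
      case False
      then have x: "x \<in> U" "x \<in> topspace X - chart_inv ` K" using that by (auto split: if_splits)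
      have "chart_inv (F (\<phi> x)) = x" using gU[OF x(1)] gK[OF x(2)] by simp
      then show ?thesis by (cases i; cases j) auto
    qed simp
    show "\<exists>j. j \<in> UNIV \<and> x \<in> ?T j \<and> g x = ?f j x" if "x \<in> topspace X" for x
    proof (cases "x \<in> U")
      case True
      then show ?thesis using gU by (intro exI[of _ True]) auto
    next
      case False
      have "chart_inv ` K \<subseteq> U" using K by (auto intro: inv_into_into)
      then have "x \<notin> chart_inv ` K" using False by blast
      then show ?thesis using that gK[of x] by (intro exI[of _ False]) simp
    qed
  qed
qed

text \<open>In charts, the transplanted map is a transition map off the support, and near the support it is
  \<open>F\<close> between two transition maps. Both smoothness and orientation are local and follow from this
  description. The map \<open>g\<close> stands for any extension of \<^term>\<open>transplant F\<close> beyond the manifold, such as the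
  one given by \<^const>\<open>inv_into\<close>.\<close>

lemma local_form_transplant:
  assumes F: "supported F" and g: "\<And>x. x \<in> topspace X \<Longrightarrow> g x = transplant F x"
    and c: "chart_on X c" and d: "chart_on X d" and p: "p \<in> local_dom c d g"
  obtains O' where "open O'" "p \<in> O'" "O' \<subseteq> local_dom c d id"
      "\<And>y. y \<in> O' \<Longrightarrow> local_expr c d g y = local_expr c d id y"
  | O' where "open O'" "p \<in> O'" "O' \<subseteq> local_dom c (U, \<phi>) id"
      "\<And>y. y \<in> O' \<Longrightarrow> F (local_expr c (U, \<phi>) id y) \<in> local_dom (U, \<phi>) d id"
      "\<And>y. y \<in> O' \<Longrightarrow> local_expr c d g y = local_expr (U, \<phi>) d id (F (local_expr c (U, \<phi>) id y))"
proof -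
  obtain Uc \<phi>c Ud \<phi>d where cd: "c = (Uc, \<phi>c)" "d = (Ud, \<phi>d)" by (metis surj_pair)
  note C = chart_onD[OF c[unfolded cd]] and D = chart_onD[OF d[unfolded cd]]
  obtain x where x: "x \<in> Uc" "g x \<in> Ud" "p = \<phi>c x" using p by (auto simp: local_dom_def cd)
  have sub: "Uc \<subseteq> topspace X" using C(1) openin_subset by blast
  have ic: "inv_into Uc \<phi>c (\<phi>c y) = y" if "y \<in> Uc" for y using C(3) that by simp
  show ?thesis
  proof (cases "x \<in> chart_inv ` K")
    case False
    let ?W = "(Uc \<inter> Ud) \<inter> (topspace X - chart_inv ` K)"
    have gx: "g y = y" if "y \<in> ?W" for y using that g transplant_outside[OF F] by auto
    have "openin X ?W" using C(1) D(1) closedin_support by (auto intro: openin_Int)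
    then have "open (\<phi>c ` ?W)" by (intro C(6)) auto
    moreover have "x \<in> ?W" using x False sub g[of x] transplant_outside[OF F, of x] by auto
    then have "p \<in> \<phi>c ` ?W" using x by blast
    moreover have "\<phi>c ` ?W \<subseteq> local_dom c d id" by (auto simp: local_dom_def cd)
    moreover have "local_expr c d g y = local_expr c d id y" if "y \<in> \<phi>c ` ?W" for y
      using that gx by (auto simp: local_expr_def cd ic)
    ultimately show ?thesis using that(1) by blast
  next
    case True
    have xU: "x \<in> U" using True K by (auto intro: inv_into_into)
    let ?W = "(Uc \<inter> U) \<inter> {y \<in> topspace X. g y \<in> Ud}"
    have "openin X {y \<in> topspace X. g y \<in> Ud}"
      using openin_continuous_map_preimage[OF continuous_map_transplant[OF F g] D(1)] by blast
    then have "openin X ?W" using C(1) chart_onD(1)[OF chart] by (auto intro: openin_Int)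
    then have "open (\<phi>c ` ?W)" by (intro C(6)) auto
    moreover have "p \<in> \<phi>c ` ?W" using x xU sub by blast
    moreover have "\<phi>c ` ?W \<subseteq> local_dom c (U, \<phi>) id" by (auto simp: local_dom_def cd)
    moreover have "F (local_expr c (U, \<phi>) id y) \<in> local_dom (U, \<phi>) d id \<and>
        local_expr c d g y = local_expr (U, \<phi>) d id (F (local_expr c (U, \<phi>) id y))"
      if "y \<in> \<phi>c ` ?W" for y
    proof -
      from that obtain z where z: "y = \<phi>c z" "z \<in> ?W" by (rule imageE)
      have l: "local_expr c (U, \<phi>) id y = \<phi> z" using z by (simp add: local_expr_def cd ic)
      have gz: "g z \<in> U" "F (\<phi> z) = \<phi> (g z)"
        using z g[of z] transplant_chart[OF F, of z] by auto
      have "local_expr c d g y = \<phi>d (g z)" using z by (simp add: local_expr_def cd ic)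
      moreover have "local_expr (U, \<phi>) d id (\<phi> (g z)) = \<phi>d (g z)"
        using gz by (simp add: local_expr_def cd chart_inv_inverse)
      moreover have "\<phi> (g z) \<in> local_dom (U, \<phi>) d id"
        using gz z by (auto simp: local_dom_def cd)
      ultimately show ?thesis by (simp add: l gz)
    qed
    ultimately show ?thesis using that(2) by blast
  qed
qed

lemma open_local_dom_id:
  assumes "chart_on X c" "chart_on X d"
  shows "open (local_dom c d id)"
proof -
  obtain Uc \<phi>c Ud \<phi>d where cd: "c = (Uc, \<phi>c)" "d = (Ud, \<phi>d)" by (metis surj_pair)
  have "local_dom c d id = \<phi>c ` (Uc \<inter> Ud)" by (auto simp: local_dom_def cd)
  then show ?thesis
    using chart_onD(1)[OF assms(1)[unfolded cd]] chart_onD(1)[OF assms(2)[unfolded cd]]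
      chart_onD(6)[OF assms(1)[unfolded cd], of "Uc \<inter> Ud"] by (simp add: openin_Int)
qed

lemma smooth_map_transplant:
  assumes F: "supported F" and g: "\<And>x. x \<in> topspace X \<Longrightarrow> g x = transplant F x"
    and atlas: "smooth_atlas X \<A>" "(U, \<phi>) \<in> \<A>" "\<B> \<subseteq> \<A>"
  shows "smooth_map X \<B> X \<B> g"
  unfolding smooth_map_def
proof (intro conjI ballI)
  show "continuous_map X X g" by (rule continuous_map_transplant[OF F g])
  fix c d assume cd: "c \<in> \<B>" "d \<in> \<B>"
  have ch: "chart_on X a" if "a \<in> \<A>" for a using atlas(1) that by (simp add: smooth_atlas_def)
  have sm: "Cinf_on (local_expr a b id) (local_dom a b id)" if "a \<in> \<A>" "b \<in> \<A>" for a b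
    using atlas(1) that by (simp add: smooth_atlas_def)
  have cd': "c \<in> \<A>" "d \<in> \<A>" using cd atlas by auto
  show "Cinf_on (local_expr c d g) (local_dom c d g)"
  proof (rule Cinf_on_local)
    fix p assume p: "p \<in> local_dom c d g"
    show "\<exists>O'. open O' \<and> p \<in> O' \<and> Cinf_on (local_expr c d g) O'"
    proof (rule local_form_transplant[OF F g ch[OF cd'(1)] ch[OF cd'(2)] p])
      fix O' assume O': "open O'" "p \<in> O'" "O' \<subseteq> local_dom c d id"
        "\<And>y. y \<in> O' \<Longrightarrow> local_expr c d g y = local_expr c d id y"
      have "Cinf_on (local_expr c d id) O'" using sm[OF cd'] O'(3) by (rule Cinf_on_subset)
      from Cinf_on_cong_imp[OF O'(1) _ this] have "Cinf_on (local_expr c d g) O'"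
        using O'(4) by simp
      then show ?thesis using O' by blast
    next
      fix O' assume O': "open O'" "p \<in> O'" "O' \<subseteq> local_dom c (U, \<phi>) id"
        "\<And>y. y \<in> O' \<Longrightarrow> F (local_expr c (U, \<phi>) id y) \<in> local_dom (U, \<phi>) d id"
        "\<And>y. y \<in> O' \<Longrightarrow> local_expr c d g y = local_expr (U, \<phi>) d id (F (local_expr c (U, \<phi>) id y))"
      have "Cinf_on (local_expr c (U, \<phi>) id) O'"
        using sm[OF cd'(1) atlas(2)] O'(3) by (rule Cinf_on_subset)
      moreover have "Cinf_on F UNIV" using F by (simp add: supported_def smooth_perm_def)
      ultimately have "Cinf_on (\<lambda>y. F (local_expr c (U, \<phi>) id y)) O'"
        using Cinf_on_compose[OF O'(1) open_UNIV subset_UNIV] by blast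
      from Cinf_on_compose[OF O'(1) open_local_dom_id[OF ch[OF atlas(2)] ch[OF cd'(2)]] _ this
          sm[OF atlas(2) cd'(2)]]
      have "Cinf_on (\<lambda>y. local_expr (U, \<phi>) d id (F (local_expr c (U, \<phi>) id y))) O'"
        using O'(4) by blast
      from Cinf_on_cong_imp[OF O'(1) _ this] have "Cinf_on (local_expr c d g) O'"
        using O'(5) by simp
      then show ?thesis using O' by blast
    qed
  qed
qed

lemma preserves_orientation_transplant:
  assumes F: "supported F" and atlas: "smooth_atlas X \<A>" "(U, \<phi>) \<in> \<A>"
    and oriented: "preserves_orientation_in \<A> id"
  shows "preserves_orientation_in \<A> (transplant F)"
  unfolding preserves_orientation_in_def jacobian_det_def[symmetric]
proof (intro ballI)
  fix c d p assume cd: "c \<in> \<A>" "d \<in> \<A>" and p: "p \<in> local_dom c d (transplant F)"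
  have ch: "chart_on X a" if "a \<in> \<A>" for a using atlas(1) that by (simp add: smooth_atlas_def)
  have der: "(local_expr a b id has_derivative frechet_derivative (local_expr a b id) (at y)) (at y)"
    if "a \<in> \<A>" "b \<in> \<A>" "y \<in> local_dom a b id" for a b y
    using atlas(1) that Cinf_on_has_derivative[of "local_expr a b id" "local_dom a b id" y]
    unfolding smooth_atlas_def by blast
  have pos: "jacobian_det (local_expr a b id) y > 0" if "a \<in> \<A>" "b \<in> \<A>" "y \<in> local_dom a b id" for a b y
    using oriented that by (simp add: preserves_orientation_in_def jacobian_det_def)
  show "jacobian_det (local_expr c d (transplant F)) p > 0"
  proof (rule local_form_transplant[OF F HOL.refl ch[OF cd(1)] ch[OF cd(2)] p])
    fix O' assume O': "open O'" "p \<in> O'" "O' \<subseteq> local_dom c d id"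
      "\<And>y. y \<in> O' \<Longrightarrow> local_expr c d (transplant F) y = local_expr c d id y"
    then have "jacobian_det (local_expr c d (transplant F)) p = jacobian_det (local_expr c d id) p"
      by (intro jacobian_det_cong[of O']) auto
    then show ?thesis using pos[OF cd] O' by auto
  next
    fix O' assume O': "open O'" "p \<in> O'" "O' \<subseteq> local_dom c (U, \<phi>) id"
      "\<And>y. y \<in> O' \<Longrightarrow> F (local_expr c (U, \<phi>) id y) \<in> local_dom (U, \<phi>) d id"
      "\<And>y. y \<in> O' \<Longrightarrow> local_expr c d (transplant F) y =
        local_expr (U, \<phi>) d id (F (local_expr c (U, \<phi>) id y))"
    let ?a = "local_expr c (U, \<phi>) id" and ?b = "local_expr (U, \<phi>) d id"
    have pc: "p \<in> local_dom c (U, \<phi>) id" "F (?a p) \<in> local_dom (U, \<phi>) d id" using O' by auto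
    have dF: "(F has_derivative frechet_derivative F (at y)) (at y)" for y
      using F by (auto simp: supported_def smooth_perm_def intro: Cinf_on_has_derivative)
    have dFa: "((\<lambda>y. F (?a y)) has_derivative
        frechet_derivative F (at (?a p)) \<circ> frechet_derivative ?a (at p)) (at p)"
      using diff_chain_at[OF der[OF cd(1) atlas(2) pc(1)] dF] by (simp add: o_def)
    have "jacobian_det (local_expr c d (transplant F)) p = jacobian_det (\<lambda>y. ?b (F (?a y))) p"
      using O' by (intro jacobian_det_cong[of O']) auto
    also have "\<dots> = jacobian_det ?b (F (?a p)) * jacobian_det (\<lambda>y. F (?a y)) p"
      by (rule jacobian_det_compose[of "\<lambda>y. F (?a y)" _ p ?b, OF dFa der[OF atlas(2) cd(2) pc(2)]])
    also have "jacobian_det (\<lambda>y. F (?a y)) p = jacobian_det F (?a p) * jacobian_det ?a p"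
      by (rule jacobian_det_compose[OF der[OF cd(1) atlas(2) pc(1)] dF])
    finally have "jacobian_det (local_expr c d (transplant F)) p =
        jacobian_det ?b (F (?a p)) * (jacobian_det F (?a p) * jacobian_det ?a p)" .
    moreover have "jacobian_det F (?a p) > 0"
      using F K(1) by (intro jacobian_det_pos_of_compact_support) (auto simp: supported_def)
    ultimately show ?thesis
      using pos[OF cd(1) atlas(2) pc(1)] pos[OF atlas(2) cd(2) pc(2)] by (metis mult_pos_pos)
  qed
qed

lemma transplant_in_Diff_group:
  assumes "supported F" "orientation_of X \<A> \<O>" "(U, \<phi>) \<in> \<O>"
  shows "transplant F \<in> carrier (Diff_group X \<A> \<O>)"
proof -
  have o: "smooth_atlas X (\<A> \<union> \<O>)" "smooth_atlas X \<O>" "preserves_orientation_in \<O> id"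
    using assms(2) by (auto simp: orientation_of_def)
  have "smooth_map X \<A> X \<A> (transplant F)"
    by (rule smooth_map_transplant[OF assms(1) HOL.refl o(1)]) (use assms in auto)
  moreover have "smooth_map X \<A> X \<A> (inv_into (topspace X) (transplant F))"
    by (rule smooth_map_transplant[OF supported_inv[OF assms(1)] inv_into_transplant[OF assms(1)] o(1)])
      (use assms in auto)
  ultimately show ?thesis
    using transplant_Bij[OF assms(1)] preserves_orientation_transplant[OF assms(1) o(2) assms(3) o(3)]
    by (simp add: Diff_group_def)
qed

lemma transplant_mult:
  assumes "supported F" "supported G"
  shows "transplant F \<otimes>\<^bsub>Diff_group X \<A> \<O>\<^esub> transplant G = transplant (F \<circ> G)"
  using transplant_Bij assms by (simp add: Diff_group_def BijGroup_def transplant_comp)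

lemma transplant_inj:
  assumes "supported F" "supported G" "transplant F = transplant G"
  shows "F = G"
proof
  fix y
  show "F y = G y"
  proof (cases "y \<in> K")
    case True
    then obtain x where x: "x \<in> U" "y = \<phi> x" using K by blast
    then show ?thesis using transplant_chart(2)[OF assms(1) x(1)] transplant_chart(2)[OF assms(2) x(1)] assms(3)
      by simp
  next
    case False
    then show ?thesis using assms by (simp add: supported_def)
  qed
qed

end

section \<open>Right-angled Artin groups act faithfully on a disc\<close>

text \<open>The centres are chosen on the unit circle with evenly spaced real parts in \<open>{0..1 / 2}\<close>; then their
  imaginary parts are at least \<open>4 / 5\<close>.\<close>

lemma annulus_tree_exists:
  assumes "finite_simplicial_graph V E"
  obtains vs q \<mu> \<delta> where "annulus_tree V E vs q \<mu> \<delta>"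
proof -
  have fin: "finite V" using assms by (simp add: finite_simplicial_graph_def)
  obtain vs where vs: "set vs = V" "distinct vs" using finite_distinct_list[OF fin] by blast
  obtain f n where f: "f ` V = {i::nat. i < n}" "inj_on f V"
    using finite_imp_inj_to_nat_seg[OF fin] by blast
  define N where "N = real (n + 1)"
  define x where "x b = real (f b) / (2 * N)" for b
  define q where "q b = Complex (x b) (sqrt (1 - (x b)\<^sup>2))" for b
  have N: "N \<ge> 1" by (simp add: N_def)
  have x: "0 \<le> x b" "x b \<le> 1 / 2" if "b \<in> V" for b
  proof -
    have "f b < n" using f(1) that by blast
    then have "real (f b) \<le> N" by (simp add: N_def)
    then show "0 \<le> x b" "x b \<le> 1 / 2" using N by (auto simp: x_def field_simps)
  qed
  have x2: "(x b)\<^sup>2 \<le> 1 / 4" if "b \<in> V" for b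
    using power_mono[OF x(2)[OF that] x(1)[OF that], of 2] by (simp add: power2_eq_square)
  have "annulus_tree V E vs q (1 / (20 * N)) (1 / (20 * N) / 40)"
  proof unfold_locales
    show "norm (q b) = 1" if "b \<in> V" for b
      using x2[OF that] by (simp add: q_def cmod_def)
    show "4 / 5 \<le> Im (q b)" if "b \<in> V" for b
    proof -
      have "4 / 5 \<le> sqrt (1 - (x b)\<^sup>2)"
        by (rule real_le_rsqrt) (use x2[OF that] in \<open>simp add: power2_eq_square\<close>)
      then show ?thesis by (simp add: q_def)
    qed
    show "4 * (1 / (20 * N)) \<le> dist (q b) (q c)" if bc: "b \<in> V" "c \<in> V" "b \<noteq> c" for b c
    proof -
      have "f b \<noteq> f c" using f(2) bc by (auto dest: inj_onD)
      then have "1 \<le> \<bar>real (f b) - real (f c)\<bar>" by linarith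
      then have "1 / (2 * N) \<le> \<bar>real (f b) - real (f c)\<bar> / (2 * N)"
        using N by (intro divide_right_mono) auto
      also have "\<dots> = \<bar>Re (q b - q c)\<bar>"
        using N by (simp add: q_def x_def diff_divide_distrib[symmetric])
      also have "\<dots> \<le> dist (q b) (q c)" unfolding dist_norm by (rule abs_Re_le_cmod)
      finally show ?thesis using N by (simp add: field_simps)
    qed
  qed (use assms vs N in \<open>auto simp: field_simps\<close>)
  then show ?thesis by (rule that)
qed

context raag_words
begin

theorem faithful_action_on_disc:
  obtains G :: "'v \<Rightarrow> complex \<Rightarrow> complex" where "\<And>v. smooth_perm (G v)"
    "\<And>v z. norm z \<ge> 2 \<Longrightarrow> G v z = z"
    "\<And>u v z. {u, v} \<in> E \<Longrightarrow> G u (G v z) = G v (G u z)"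
    "\<And>w. w \<in> words V \<Longrightarrow> word_map G w = id \<Longrightarrow> w \<doteq> []"
proof -
  obtain vs q \<mu> \<delta> where "annulus_tree V E vs q \<mu> \<delta>" using annulus_tree_exists[OF graph] .
  then interpret annulus_tree V E vs q \<mu> \<delta> .
  show ?thesis
  proof (rule that[of "tree_map (card V) V"])
    show "smooth_perm (tree_map (card V) V v)" for v by (rule smooth_perm_tree_map)
    show "tree_map (card V) V v z = z" if "norm z \<ge> 2" for v z using that by (rule tree_map_norm)
    show "tree_map (card V) V u (tree_map (card V) V v z) = tree_map (card V) V v (tree_map (card V) V u z)"
      if "{u, v} \<in> E" for u v z using that by (rule tree_map_commute)
    show "w \<doteq> []" if "w \<in> words V" "word_map (tree_map (card V) V) w = id" for w
      using that by (rule tree_map_faithful)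
  qed
qed

lemma word_map_injective:
  assumes G: "\<And>v. bij (G v)" "\<And>u v z. {u, v} \<in> E \<Longrightarrow> G u (G v z) = G v (G u z)"
    "\<And>w. w \<in> words V \<Longrightarrow> word_map G w = id \<Longrightarrow> w \<doteq> []"
    and uv: "u \<in> words V" "v \<in> words V" "word_map G u = word_map G v"
  shows "u \<doteq> v"
proof -
  define u' where "u' = rev (map (\<lambda>(s, b). (s, \<not> b)) u)"
  have u': "u' \<in> words V" using uv(1) by (auto simp: u'_def)
  have eq: "a \<doteq> b \<Longrightarrow> word_map G a = word_map G b" for a b
    by (rule word_map_raag_eq[OF G(1,2)])
  have l: "u' @ u \<doteq> []" unfolding u'_def using uv(1) by (rule word_eq_left_inverse)
  have u'': "rev (map (\<lambda>(s, b). (s, \<not> b)) u') = u"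
    by (auto simp: u'_def rev_map o_def case_prod_beta)
  have "rev (map (\<lambda>(s, b). (s, \<not> b)) u') @ u' \<doteq> []" using u' by (rule word_eq_left_inverse)
  then have r: "u @ u' \<doteq> []" unfolding u'' .
  have "word_map G (u' @ v) = word_map G (u' @ u)" by (simp only: word_map_append uv(3))
  also have "\<dots> = id" using eq[OF l] by simp
  finally have "u' @ v \<doteq> []" using G(3)[of "u' @ v"] u' uv by auto
  then have "u @ (u' @ v) \<doteq> u @ []" using uv(1) by (rule word_eq_append_left)
  moreover have "(u @ u') @ v \<doteq> [] @ v" using r uv(2) by (rule word_eq_append_right)
  ultimately show ?thesis by simp (meson word_eq.sym word_eq.trans)
qed

end

text \<open>A linear isometry followed by a homothety moves the disc of radius 2 into a given ball of the plane in
  which the charts take their values.\<close>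

lemma conjugate_into_ball:
  fixes y0 :: "real ^ 2" and G :: "'v \<Rightarrow> complex \<Rightarrow> complex"
  assumes G: "\<And>v. smooth_perm (G v)" "\<And>v z. norm z \<ge> 2 \<Longrightarrow> G v z = z" and "\<rho> > 0"
  obtains F :: "'v \<Rightarrow> real ^ 2 \<Rightarrow> real ^ 2" and A K where "compact K" "K \<subseteq> ball y0 \<rho>" "bij A"
    "\<And>v. smooth_perm (F v)" "\<And>v y. y \<notin> K \<Longrightarrow> F v y = y" "\<And>v z. F v (A z) = A (G v z)"
proof -
  have "DIM(complex) = DIM(real ^ 2)" by simp
  then obtain f :: "complex \<Rightarrow> real ^ 2" and f' where f: "linear f" "linear f'" "\<And>x. norm (f x) = norm x"
    "\<And>x. f' (f x) = x" "\<And>y. f (f' y) = y"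
    by (rule isomorphisms_UNIV_UNIV) blast
  have bl: "bounded_linear f" "bounded_linear f'" using f linear_conv_bounded_linear by auto
  define A where "A z = y0 + (\<rho> / 3) *\<^sub>R f z" for z
  define A' where "A' y = f' ((3 / \<rho>) *\<^sub>R (y - y0))" for y
  have inv: "A' (A z) = z" "A (A' y) = y" for z y
    using f(4,5) assms(3) by (auto simp: A_def A'_def)
  have cA: "Cinf_on A UNIV"
    unfolding A_def[abs_def]
    by (intro Cinf_on_add Cinf_on_const open_UNIV Cinf_on_linear
        bounded_linear_compose[OF bounded_linear_scaleR_right bl(1)])
  have "Cinf_on (\<lambda>y. f' ((3 / \<rho>) *\<^sub>R y) + - f' ((3 / \<rho>) *\<^sub>R y0)) UNIV"
    by (intro Cinf_on_add Cinf_on_const open_UNIV Cinf_on_linear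
        bounded_linear_compose[OF bl(2) bounded_linear_scaleR_right])
  then have cA': "Cinf_on A' UNIV"
    using f(2) by (simp add: A'_def[abs_def] scaleR_diff_right linear_diff)
  have con: "Cinf_on (\<lambda>y. A (H (A' y))) UNIV" if "Cinf_on H UNIV" for H
    using Cinf_on_compose[OF open_UNIV open_UNIV subset_UNIV
        Cinf_on_compose[OF open_UNIV open_UNIV subset_UNIV cA' that] cA] .
  show ?thesis
  proof (rule that[of "A ` cball 0 2" A "\<lambda>v y. A (G v (A' y))"])
    show "bij A" using inv by (intro bijI injI) (metis, metis surjI)
    show "compact (A ` cball 0 2)"
      by (intro compact_continuous_image compact_cball continuous_on_subset[OF Cinf_on_imp_continuous_on[OF cA]])
        simp
    show "A ` cball 0 2 \<subseteq> ball y0 \<rho>"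
      using assms(3) f(3) by (auto simp: A_def dist_norm)
    show "smooth_perm (\<lambda>y. A (G v (A' y)))" for v
    proof (rule smooth_permI(1))
      show "Cinf_on (\<lambda>y. A (G v (A' y))) UNIV" "Cinf_on (\<lambda>y. A (inv_into UNIV (G v) (A' y))) UNIV"
        using G(1)[of v] by (auto simp: smooth_perm_def intro: con)
      show "A (G v (A' (A (inv_into UNIV (G v) (A' y))))) = y" "A (inv_into UNIV (G v) (A' (A (G v (A' y))))) = y" for y
        using smooth_perm_bij[OF G(1)[of v]]
        by (simp_all add: inv bij_is_surj bij_is_inj surj_f_inv_f)
    qed
    show "A (G v (A' y)) = y" if "y \<notin> A ` cball 0 2" for v y
    proof -
      have "A' y \<notin> cball 0 2" using that inv(2) by (metis imageI)
      then show ?thesis using G(2)[of "A' y" v] inv(2) by simp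
    qed
  qed (use inv in auto)
qed

text \<open>The chart is taken from the orienting atlas, so that the transition maps entering the transplanted
  diffeomorphisms have positive Jacobian determinant.\<close>

lemma raag_embeds_into_Diff_group:
  fixes X :: "'a topology" and \<A> \<O> :: "('a, 2) chart set"
    and V :: "'v set" and E :: "'v set set"
  assumes "smooth_manifold X \<A>" "orientation_of X \<A> \<O>" "finite_simplicial_graph V E"
  shows "\<exists>h. h \<in> hom (raag V E) (Diff_group X \<A> \<O>) \<and> inj_on h (carrier (raag V E))"
proof -
  interpret raag_words V E by unfold_locales (rule assms)
  let ?R = "{commutator_word v w | v w. {v, w} \<in> E}"
  have X: "topspace X \<noteq> {}" "Hausdorff_space X" using assms(1) by (auto simp: smooth_manifold_def)
  have O: "smooth_atlas X \<O>" using assms(2) by (simp add: orientation_of_def)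
  obtain x0 where "x0 \<in> topspace X" using X by blast
  then obtain U \<phi> where e: "(U, \<phi>) \<in> \<O>" "x0 \<in> U"
    using O unfolding smooth_atlas_def by (metis UN_E prod.collapse)
  then have ch: "chart_on X (U, \<phi>)" using O by (auto simp: smooth_atlas_def)
  obtain \<rho> where \<rho>: "\<rho> > 0" "ball (\<phi> x0) \<rho> \<subseteq> \<phi> ` U"
    using chart_onD(2)[OF ch] e(2) open_contains_ball by blast
  obtain G :: "'v \<Rightarrow> complex \<Rightarrow> complex" where G: "\<And>v. smooth_perm (G v)"
    "\<And>v z. norm z \<ge> 2 \<Longrightarrow> G v z = z"
    "\<And>u v z. {u, v} \<in> E \<Longrightarrow> G u (G v z) = G v (G u z)"
    "\<And>w. w \<in> words V \<Longrightarrow> word_map G w = id \<Longrightarrow> w \<doteq> []"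
    using faithful_action_on_disc by blast
  obtain F :: "'v \<Rightarrow> real ^ 2 \<Rightarrow> real ^ 2" and A K where K: "compact K" "K \<subseteq> ball (\<phi> x0) \<rho>"
    and A: "bij A" and F: "\<And>v. smooth_perm (F v)" "\<And>v y. y \<notin> K \<Longrightarrow> F v y = y"
    and FA: "\<And>v z. F v (A z) = A (G v z)"
    by (rule conjugate_into_ball[of G \<rho> "\<phi> x0"]) (rule G(1), erule G(2), rule \<rho>(1), rule that)
  have comm: "F u (F v y) = F v (F u y)" if "{u, v} \<in> E" for u v y
  proof -
    obtain z where "y = A z" using A by (meson bij_pointE)
    then show ?thesis using G(3)[OF that] by (simp add: FA)
  qed
  have faithful: "w \<doteq> []" if w: "w \<in> words V" "word_map F w = id" for w
  proof (rule G(4)[OF w(1)])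
    have "A (word_map G w z) = A z" for z
      using word_map_semiconj[of UNIV F G UNIV A w z] w(2) F(1) G(1)
      by (auto simp: FA smooth_perm_bij bij_is_surj)
    then show "word_map G w = id" using A by (metis bij_is_inj eq_id_iff injD)
  qed
  interpret chart_support X U \<phi> K
    by unfold_locales (use ch X K \<rho> in auto)
  have sup: "supported (word_map F w)" if "w \<in> words V" for w
    unfolding supported_def
    using smooth_perm_word_map[of V F w] word_map_fixes[of V F _ w] that F smooth_perm_bij by blast
  have bij: "bij (F v)" for v using F(1) smooth_perm_bij by blast
  define h where "h C = transplant (word_map F (SOME w. w \<in> C))" for C
  have h: "h {w. u \<doteq> w} = transplant (word_map F u)" if "u \<in> words V" for u
  proof -
    have "u \<in> {w. u \<doteq> w}" using that by (intro CollectI word_eq.refl)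
    then have "(SOME w. w \<in> {w. u \<doteq> w}) \<in> {w. u \<doteq> w}" by (rule someI)
    then have "u \<doteq> (SOME w. w \<in> {w. u \<doteq> w})" by (rule CollectD)
    from word_map_raag_eq[OF bij comm this] show ?thesis by (simp only: h_def)
  qed
  have carr: "carrier (raag V E) = (\<lambda>u. {w. u \<doteq> w}) ` words V"
    unfolding raag_def by (rule presented_group_carrier)
  have "h \<in> hom (raag V E) (Diff_group X \<A> \<O>)"
  proof (rule homI)
    fix x assume "x \<in> carrier (raag V E)"
    then obtain u where u: "u \<in> words V" "x = {w. u \<doteq> w}" unfolding carr by blast
    then show "h x \<in> carrier (Diff_group X \<A> \<O>)"
      using transplant_in_Diff_group[OF sup[OF u(1)] assms(2) e(1)] h by simp
    fix y assume "y \<in> carrier (raag V E)"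
    then obtain v where v: "v \<in> words V" "y = {w. v \<doteq> w}" unfolding carr by blast
    have "h (x \<otimes>\<^bsub>raag V E\<^esub> y) = h {w. u @ v \<doteq> w}"
      unfolding raag_def u(2) v(2) using presented_group_mult[OF u(1) v(1)] by simp
    also have "\<dots> = transplant (word_map F u \<circ> word_map F v)"
      using h[of "u @ v"] u v by (simp add: word_map_append)
    also have "\<dots> = h x \<otimes>\<^bsub>Diff_group X \<A> \<O>\<^esub> h y"
      unfolding u(2) v(2) h[OF u(1)] h[OF v(1)]
      by (rule transplant_mult[OF sup[OF u(1)] sup[OF v(1)], symmetric])
    finally show "h (x \<otimes>\<^bsub>raag V E\<^esub> y) = h x \<otimes>\<^bsub>Diff_group X \<A> \<O>\<^esub> h y" .
  qed
  moreover have "inj_on h (carrier (raag V E))"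
  proof (rule inj_onI)
    fix x y assume "x \<in> carrier (raag V E)" "y \<in> carrier (raag V E)" and eq: "h x = h y"
    then obtain u v where u: "u \<in> words V" "x = {w. u \<doteq> w}" and v: "v \<in> words V" "y = {w. v \<doteq> w}"
      unfolding carr by blast
    have "word_map F u = word_map F v"
      using transplant_inj[OF sup[OF u(1)] sup[OF v(1)]] eq h u v by simp
    then have "u \<doteq> v"
      by (intro word_map_injective[of F u v] u v) (rule bij, erule comm, erule (1) faithful)
    then show "x = y" unfolding u(2) v(2) by (blast intro: word_eq.sym word_eq.trans)
  qed
  ultimately show ?thesis by blast
qed

theorem theorem10p1:
  fixes X :: "'a topology" and \<A> :: "('a, 2) chart set"
    and V :: "'v set" and E :: "'v set set"
  assumes "smooth_manifold X \<A>" and "orientable X \<A>"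
    and "finite_simplicial_graph V E"
  shows "\<forall>\<O>. orientation_of X \<A> \<O> \<longrightarrow>
    (\<exists>h. h \<in> hom (raag V E) (Diff_group X \<A> \<O>) \<and> inj_on h (carrier (raag V E)))"
  using raag_embeds_into_Diff_group[OF assms(1) _ assms(3)] by blast

end
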